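(* Let $n\ge 3$ be an integer. There exists a constant $c_n>0$, depending only on $n$, such that for every convex $n$-gon $P\subset\mathbb{R}^2$, $$c_n\,\delta(P)\ \ge\ \sigma_s^2(P)+\sigma_r^2(P)+|P|\,\sigma_a^2(P).$$
   Context: Let $P\subset\mathbb{R}^2$ be a convex $n$-gon with vertices $A_1,\dots,A_n$ listed in cyclic order along its boundary, with indices taken modulo $n$. Its side lengths are $l_i:=|A_iA_{i+1}|$, $i=1,\dots,n$; $|P|$ denotes the area of $P$ and $L(P)=\sum_{i=1}^n l_i$ its perimeter. The polygonal isoperimetric deficit is $$\delta(P):=L^2(P)-4n\tan\frac{\pi}{n}\,|P|,$$ where $L^2(P)=(L(P))^2$; by the classical polygonal isoperimetric inequality $\delta(P)\ge 0$. Let $O=\frac1n\sum_{i=1}^n A_i$ be the barycenter of the vertices. The radii of $P$ are $r_i:=|OA_i|$, $i=1,\dots,n$. The central angles of $P$ are $x_i$, $i=1,\dots,n$, where $x_i$ is the angle between the vectors $\overrightarrow{OA_i}$ and $\overrightarrow{OA_{i+1}}$ (for a convex polygon, $\sum_{i=1}^n x_i=2\pi$). The variances of the side lengths, of the radii and of the central angles are $$\sigma_s^2(P):=\frac1n\sum_{i=1}^n l_i^2-\frac1{n^2}\Big(\sum_{i=1}^n l_i\Big)^2,\qquad \sigma_r^2(P):=\frac1n\sum_{i=1}^n r_i^2-\frac1{n^2}\Big(\sum_{i=1}^n r_i\Big)^2,$$ $$\sigma_a^2(P):=\frac1n\sum_{i=1}^n x_i^2-\frac1{n^2}\Big(\sum_{i=1}^n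 x_i\Big)^2.$$ *)

theory Defs
  imports "HOL-Analysis.Analysis"
begin

text \<open>
  \<open>convex_ngon n P A\<close>: the convex polygon \<open>P\<close> (as a plane region) has exactly the \<open>n\<close>
  vertices \<open>A 0, \<dots>, A (n - 1)\<close>, listed in cyclic order along the boundary (in either
  direction). Only the values \<open>A i\<close> with \<open>i < n\<close> matter; the successor index is taken
  modulo \<open>n\<close>. Vertices are extreme points, so no vertex has a straight angle; for
  \<open>n \<ge> 3\<close> the region automatically has nonempty interior, since a point or a segment has
  at most two extreme points.
\<close>

definition convex_ngon :: "nat \<Rightarrow> (real^2) set \<Rightarrow> (nat \<Rightarrow> real^2) \<Rightarrow> bool" where
  "convex_ngon n P A \<longleftrightarrow>
     polytope P \<and>
     inj_on A {..<n} \<and>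
     A ` {..<n} = {v. v extreme_point_of P} \<and>
     (\<forall>i<n. closed_segment (A i) (A (Suc i mod n)) edge_of P)"

definition side_length :: "nat \<Rightarrow> (nat \<Rightarrow> real^2) \<Rightarrow> nat \<Rightarrow> real" where
  "side_length n A i = dist (A i) (A (Suc i mod n))"

definition perimeter :: "nat \<Rightarrow> (nat \<Rightarrow> real^2) \<Rightarrow> real" where
  "perimeter n A = (\<Sum>i<n. side_length n A i)"

definition area :: "(real^2) set \<Rightarrow> real" where
  "area P = measure lebesgue P"

definition isoperimetric_deficit :: "nat \<Rightarrow> (real^2) set \<Rightarrow> (nat \<Rightarrow> real^2) \<Rightarrow> real" where
  "isoperimetric_deficit n P A =
     (perimeter n A)\<^sup>2 - 4 * real n * tan (pi / real n) * area P"

definition barycenter :: "nat \<Rightarrow> (nat \<Rightarrow> real^2) \<Rightarrow> real^2" where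
  "barycenter n A = (1 / real n) *\<^sub>R (\<Sum>i<n. A i)"

definition radius :: "nat \<Rightarrow> (nat \<Rightarrow> real^2) \<Rightarrow> nat \<Rightarrow> real" where
  "radius n A i = dist (barycenter n A) (A i)"

text \<open>
  The unoriented angle in \<open>[0, \<pi>]\<close>; it is meaningful for nonzero vectors only. In its use
  below the vectors are nonzero, because the barycenter of the vertices is an interior point.
\<close>

definition vector_angle :: "real^2 \<Rightarrow> real^2 \<Rightarrow> real" where
  "vector_angle u v = arccos ((u \<bullet> v) / (norm u * norm v))"

definition central_angle :: "nat \<Rightarrow> (nat \<Rightarrow> real^2) \<Rightarrow> nat \<Rightarrow> real" where
  "central_angle n A i =
     vector_angle (A i - barycenter n A) (A (Suc i mod n) - barycenter n A)"

definition variance_of :: "nat \<Rightarrow> (nat \<Rightarrow> real) \<Rightarrow> real" where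
  "variance_of n f = (1 / real n) * (\<Sum>i<n. (f i)\<^sup>2) - (1 / (real n)\<^sup>2) * (\<Sum>i<n. f i)\<^sup>2"

end

theory Submission
  imports Defs
begin

text \<open>
  Write \<open>a = \<pi> / n\<close>, \<open>l i\<close> for the side lengths, \<open>L\<close> for the perimeter and \<open>S\<close> for the area. The proof
  rests on one algebraic identity for closed polygons in the complex plane
  (\<open>closed_fan_identity\<close>): for positive angles \<open>\<alpha> i\<close> with sum \<open>\<pi>\<close>,
  the quantity \<open>(\<Sum>i. (l i)\<^sup>2 * cot (\<alpha> i)) - 4 * S\<close> is an explicit sum of squares. It generalizes the
  weighted Weitzenboeck inequality for triangles and follows from it by cutting the polygon into
  the triangles of a fan. The identity is used with two choices of the angles.

  Taking \<open>\<alpha> i = \<pi> * l i / L\<close> and dropping the squares leaves \<open>4 * S\<close> bounded by \<open>(L / \<pi>)\<^sup>2\<close> times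
  the sum of the values of \<open>x\<^sup>2 * cot x\<close> at the points \<open>\<alpha> i\<close>, whose mean is \<open>a\<close>.
  This function is concave on \<open>]0, \<pi>[\<close>, with a quantitative gain
  (\<open>cot_square_strong_tangent_bound\<close>), so Jensen's inequality gives the polygonal isoperimetric
  inequality and, beyond it, a bound of the variance of the sides by the deficit.

  Taking \<open>\<alpha> i = a\<close> for all \<open>i\<close> gives the defect \<open>Q = cot a * (\<Sum>i. (l i)\<^sup>2) - 4 * S\<close>. Up to a factor it
  is the deficit plus a multiple of the variance of the sides, hence is bounded by the deficit
  (\<open>spectral_defect_le_perimeter_defect\<close>). Now the squares are kept: they say that consecutive
  diagonals from one vertex are related almost as in a regular polygon. Hence there is a regular
  polygon, centred at the vertex barycenter, whose vertices are within a multiple of \<open>\<surd>Q\<close> of the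
  given ones (\<open>near_regular_barycenter\<close>). Since all three variances vanish for regular polygons and
  depend on the vertices in a Lipschitz way, they are bounded by a multiple of \<open>Q\<close>
  (\<open>variances_le_near_regular\<close>); the factor \<open>S\<close> makes the statement about angles scale correctly.

  For the passage from convex regions to closed polygons it suffices that the area of a convex
  polygon is at most the signed area of its fan (\<open>convex_ngon_area_le_fan\<close>), which holds because the
  fan covers the polygon and its triangles are all oriented in the same way.
\<close>

section \<open>The fan identity\<close>

text \<open>
  The elementary triangle step. Think of \<open>w\<close>, \<open>v\<close> and \<open>v - w\<close> as the sides of a triangle; if
  it is positively oriented and its angles opposite to \<open>v - w\<close>, \<open>w\<close> and \<open>v\<close> are \<open>\<alpha>\<close>, \<open>\<theta>\<close> and \<open>\<pi> - (\<theta> + \<alpha>)\<close>, the left-hand side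
  vanishes. For other triangles the quadratic form on the left is a perfect square up to a factor,
  because its discriminant vanishes by the addition theorem; the square measures the failure of
  \<open>v\<close> to be the correct rotated and rescaled copy of \<open>w\<close>.
\<close>

lemma fan_step:
  fixes w v :: complex
  assumes "sin \<alpha> \<noteq> 0" "sin \<theta> \<noteq> 0" "sin (\<theta> + \<alpha>) \<noteq> 0"
  shows "(cmod (v - w))\<^sup>2 * cot \<alpha> + (cmod w)\<^sup>2 * cot \<theta> - (cmod v)\<^sup>2 * cot (\<theta> + \<alpha>)
           - 2 * Im (cnj w * v)
         = (cmod (sin (\<theta> + \<alpha>) *\<^sub>R (cis \<alpha> * w) - sin \<theta> *\<^sub>R v))\<^sup>2
             / (sin \<alpha> * sin \<theta> * sin (\<theta> + \<alpha>))"
proof -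
  define s c p q S C where "s = sin \<alpha>" and "c = cos \<alpha>" and "p = sin \<theta>" and "q = cos \<theta>"
    and "S = sin (\<theta> + \<alpha>)" and "C = cos (\<theta> + \<alpha>)"
  define a b x y where "a = Re w" and "b = Im w" and "x = Re v" and "y = Im v"
  have sc: "s\<^sup>2 + c\<^sup>2 = 1" "p\<^sup>2 + q\<^sup>2 = 1" by (simp_all add: s_def c_def p_def q_def)
  have S: "S = p * c + q * s" and C: "C = q * c - p * s"
    by (simp_all add: S_def C_def s_def c_def p_def q_def sin_add cos_add)
  have nz: "s \<noteq> 0" "p \<noteq> 0" "S \<noteq> 0" using assms by (simp_all add: s_def p_def S_def)
  have cots: "c / s + q / p = S / (s * p)" "c / s - C / S = p / (s * S)"
    using nz sc by (simp_all add: field_simps S C power2_eq_square) algebra+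
  have norm_sq: "(cmod z)\<^sup>2 = (Re z)\<^sup>2 + (Im z)\<^sup>2" for z
    by (simp add: cmod_power2)
  have "((x - a)\<^sup>2 + (y - b)\<^sup>2) * (c / s) + (a\<^sup>2 + b\<^sup>2) * (q / p) - (x\<^sup>2 + y\<^sup>2) * (C / S)
           - 2 * (a * y - b * x)
      = (a\<^sup>2 + b\<^sup>2) * (c / s + q / p) + (x\<^sup>2 + y\<^sup>2) * (c / s - C / S)
          - 2 * (a * x + b * y) * (c / s) - 2 * (a * y - b * x)"
    by (simp add: algebra_simps power2_eq_square)
  also have "\<dots> = (S\<^sup>2 * (a\<^sup>2 + b\<^sup>2) + p\<^sup>2 * (x\<^sup>2 + y\<^sup>2)
                  - 2 * S * p * (c * (a * x + b * y) + s * (a * y - b * x))) / (s * p * S)"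
    unfolding cots using nz by (simp add: field_simps power2_eq_square)
  also have "S\<^sup>2 * (a\<^sup>2 + b\<^sup>2) + p\<^sup>2 * (x\<^sup>2 + y\<^sup>2)
                  - 2 * S * p * (c * (a * x + b * y) + s * (a * y - b * x))
             = (S * (c * a - s * b) - p * x)\<^sup>2 + (S * (c * b + s * a) - p * y)\<^sup>2"
    using sc by algebra
  finally show ?thesis
    unfolding norm_sq cot_def
    by (simp add: s_def c_def p_def q_def S_def C_def a_def b_def x_def y_def algebra_simps)
qed

text \<open>
  Twice the signed area enclosed by the closed polygon \<open>z 0, \<dots>, z n = z 0\<close>, as a sum over the
  triangles with apex \<open>z 0\<close>. For closed polygons this is the usual shoelace sum; the form with an
  apex suits the inductive argument and the triangulation of a convex polygon alike.
\<close>

definition fan_area2 :: "nat \<Rightarrow> (nat \<Rightarrow> complex) \<Rightarrow> real" where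
  "fan_area2 n z = (\<Sum>i<n. Im (cnj (z i - z 0) * (z (Suc i) - z 0)))"

text \<open>
  Adding up the triangle steps along the fan with apex \<open>z 0\<close>. The diagonal from \<open>z 0\<close> to \<open>z k\<close>
  belongs to two neighbouring triangles and its weights \<open>cot (\<theta> k)\<close> and \<open>cot (\<pi> - \<theta> k)\<close> cancel, so
  that only the last diagonal survives.
\<close>

lemma open_fan_identity:
  fixes z :: "nat \<Rightarrow> complex" and \<alpha> :: "nat \<Rightarrow> real"
  defines "\<theta> \<equiv> \<lambda>k. \<Sum>i<k. \<alpha> i"
  assumes pos: "\<And>i. i < n \<Longrightarrow> 0 < \<alpha> i" and "1 \<le> k" "k \<le> n" and "\<theta> k < pi"
  shows "(\<Sum>i<k. (cmod (z (Suc i) - z i))\<^sup>2 * cot (\<alpha> i)) - (cmod (z k - z 0))\<^sup>2 * cot (\<theta> k)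
           - 2 * fan_area2 k z
         = (\<Sum>i\<in>{1..<k}.
             (cmod (sin (\<theta> (Suc i)) *\<^sub>R (cis (\<alpha> i) * (z i - z 0)) - sin (\<theta> i) *\<^sub>R (z (Suc i) - z 0)))\<^sup>2
               / (sin (\<alpha> i) * sin (\<theta> i) * sin (\<theta> (Suc i))))"
  using assms(3-5)
proof (induction k rule: dec_induct)
  case base
  then show ?case by (simp add: fan_area2_def \<theta>_def)
next
  case (step k)
  have th: "\<theta> (Suc k) = \<theta> k + \<alpha> k" by (simp add: \<theta>_def)
  have a: "0 < \<alpha> k" using pos step.prems by simp
  have "\<theta> k > 0" unfolding \<theta>_def using pos step.hyps step.prems
    by (intro sum_pos) (auto simp: lessThan_empty_iff)
  then have sins: "sin (\<alpha> k) > 0" "sin (\<theta> k) > 0" "sin (\<theta> k + \<alpha> k) > 0"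
    using a step.prems th by (auto intro!: sin_gt_zero)
  have IH: "(\<Sum>i<k. (cmod (z (Suc i) - z i))\<^sup>2 * cot (\<alpha> i)) - (cmod (z k - z 0))\<^sup>2 * cot (\<theta> k)
           - 2 * fan_area2 k z
         = (\<Sum>i\<in>{1..<k}.
             (cmod (sin (\<theta> (Suc i)) *\<^sub>R (cis (\<alpha> i) * (z i - z 0)) - sin (\<theta> i) *\<^sub>R (z (Suc i) - z 0)))\<^sup>2
               / (sin (\<alpha> i) * sin (\<theta> i) * sin (\<theta> (Suc i))))"
    using step.IH step.prems a th by simp
  have "(\<Sum>i<Suc k. (cmod (z (Suc i) - z i))\<^sup>2 * cot (\<alpha> i))
        - (cmod (z (Suc k) - z 0))\<^sup>2 * cot (\<theta> (Suc k)) - 2 * fan_area2 (Suc k) z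
      = ((\<Sum>i<k. (cmod (z (Suc i) - z i))\<^sup>2 * cot (\<alpha> i)) - (cmod (z k - z 0))\<^sup>2 * cot (\<theta> k)
           - 2 * fan_area2 k z)
        + ((cmod ((z (Suc k) - z 0) - (z k - z 0)))\<^sup>2 * cot (\<alpha> k) + (cmod (z k - z 0))\<^sup>2 * cot (\<theta> k)
           - (cmod (z (Suc k) - z 0))\<^sup>2 * cot (\<theta> k + \<alpha> k)
           - 2 * Im (cnj (z k - z 0) * (z (Suc k) - z 0)))"
    by (simp add: fan_area2_def th)
  then show ?case
    unfolding IH using sins fan_step[of "\<alpha> k" "\<theta> k" "z (Suc k) - z 0" "z k - z 0"] step(1)
    by (simp add: th)
qed

text \<open>
  When the polygon closes up and the weights' angles add up to \<open>\<pi>\<close>, the last diagonal of the fan is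
  itself a side, and its coefficient \<open>- cot (\<pi> - \<alpha>)\<close> is the weight \<open>cot \<alpha>\<close> of that side. For a
  polygon inscribed in a circle with half central angles \<open>\<alpha> i\<close> all squares vanish.
\<close>

lemma closed_fan_identity:
  fixes z :: "nat \<Rightarrow> complex" and \<alpha> :: "nat \<Rightarrow> real"
  defines "\<theta> \<equiv> \<lambda>k. \<Sum>i<k. \<alpha> i"
  assumes "n \<ge> 2" and closed: "z n = z 0"
    and pos: "\<And>i. i < n \<Longrightarrow> 0 < \<alpha> i" and total: "\<theta> n = pi"
  shows "(\<Sum>i<n. (cmod (z (Suc i) - z i))\<^sup>2 * cot (\<alpha> i)) - 2 * fan_area2 n z
         = (\<Sum>i\<in>{1..<n - 1}.
             (cmod (sin (\<theta> (Suc i)) *\<^sub>R (cis (\<alpha> i) * (z i - z 0)) - sin (\<theta> i) *\<^sub>R (z (Suc i) - z 0)))\<^sup>2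
               / (sin (\<alpha> i) * sin (\<theta> i) * sin (\<theta> (Suc i))))"
proof -
  obtain m where n: "n = Suc m" and m: "m \<ge> 1" using \<open>n \<ge> 2\<close> by (cases n) auto
  have th: "\<theta> m = pi - \<alpha> m" using total by (simp add: \<theta>_def n)
  have "cot (pi - \<alpha> m) = - cot (\<alpha> m)" by (simp add: cot_def)
  moreover have "\<theta> m < pi" using th pos[of m] n by simp
  ultimately show ?thesis
    using open_fan_identity[of n \<alpha> m z] pos m n closed th unfolding \<theta>_def
    by (simp add: fan_area2_def norm_minus_commute)
qed

lemma sum_angle_bounds:
  fixes \<alpha> :: "nat \<Rightarrow> real"
  assumes pos: "\<And>i. i < n \<Longrightarrow> 0 < \<alpha> i" and "0 < k" "k < n"
  shows "0 < (\<Sum>i<k. \<alpha> i)" "(\<Sum>i<k. \<alpha> i) < (\<Sum>i<n. \<alpha> i)"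
proof -
  show "0 < (\<Sum>i<k. \<alpha> i)" using assms by (intro sum_pos) auto
  show "(\<Sum>i<k. \<alpha> i) < (\<Sum>i<n. \<alpha> i)"
    using assms by (intro sum_strict_mono2[where b = k]) (auto intro: less_imp_le)
qed

text \<open>
  An upper bound for the area in terms of the side lengths alone, with freely chosen angles. It is
  attained by the cyclic polygon whose half central angles are \<open>\<alpha> i\<close>; this replaces the theorem that
  among all polygons with given sides the cyclic one has the largest area.
\<close>

lemma fan_area_le_weighted_squares:
  fixes z :: "nat \<Rightarrow> complex" and \<alpha> :: "nat \<Rightarrow> real"
  assumes "n \<ge> 2" and "z n = z 0"
    and pos: "\<And>i. i < n \<Longrightarrow> 0 < \<alpha> i" and total: "(\<Sum>i<n. \<alpha> i) = pi"
  shows "2 * fan_area2 n z \<le> (\<Sum>i<n. (cmod (z (Suc i) - z i))\<^sup>2 * cot (\<alpha> i))"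
proof -
  let ?\<theta> = "\<lambda>k. \<Sum>i<k. \<alpha> i"
  have "0 \<le> sin (\<alpha> i) * sin (?\<theta> i) * sin (?\<theta> (Suc i))" if "i \<in> {1..<n - 1}" for i
  proof -
    have "0 < ?\<theta> i" "?\<theta> (Suc i) < pi" 
      using that sum_angle_bounds[of n \<alpha>] pos total by (auto simp del: sum.lessThan_Suc)
    moreover have "0 < \<alpha> i" using that pos[of i] by auto
    ultimately show ?thesis
      by (intro mult_nonneg_nonneg sin_ge_zero) auto
  qed
  then have "0 \<le> (\<Sum>i<n. (cmod (z (Suc i) - z i))\<^sup>2 * cot (\<alpha> i)) - 2 * fan_area2 n z"
    by (subst closed_fan_identity[OF assms(1,2) pos total])
       (auto intro!: sum_nonneg divide_nonneg_nonneg simp del: sum.lessThan_Suc)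
  then show ?thesis by simp
qed

section \<open>Strong concavity of \<open>x\<^sup>2 cot x\<close>\<close>

text \<open>
  Where the cosine is positive this says \<open>x \<le> tan x\<close>; the product form covers the obtuse
  range as well.
\<close>

lemma x_cos_le_sin:
  fixes x :: real
  assumes "0 \<le> x" "x \<le> pi"
  shows "x * cos x \<le> sin x"
proof -
  have "sin 0 - 0 * cos 0 \<le> sin x - x * cos x"
  proof (rule DERIV_nonneg_imp_nondecreasing[OF assms(1)])
    fix t assume t: "0 \<le> t" "t \<le> x"
    have "((\<lambda>t. sin t - t * cos t) has_real_derivative t * sin t) (at t)"
      by (auto intro!: derivative_eq_intros)
    moreover have "0 \<le> t * sin t" using t assms by (intro mult_nonneg_nonneg sin_ge_zero) auto
    ultimately show "\<exists>y. ((\<lambda>t. sin t - t * cos t) has_real_derivative y) (at t) \<and> 0 \<le> y"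
      by blast
  qed
  then show ?thesis by simp
qed

text \<open>
  The quotient is the second derivative of \<open>x\<^sup>2 cot x\<close>. It vanishes at \<open>0\<close>, so concavity cannot be
  uniform on \<open>]0, \<pi>[\<close>; the linear bound \<open>- x\<close> is what survives down to the origin.
\<close>

lemma cot_square_second_derivative:
  fixes x :: real
  assumes "0 < x" "x < pi"
  shows "((2 * sin x * cos x - 4 * x + 2 * x\<^sup>2 * cot x) / (sin x)\<^sup>2) \<le> - x"
proof -
  define s c where "s = sin x" and "c = cos x"
  have s: "s > 0" using assms by (simp add: s_def sin_gt_zero)
  have sc: "s\<^sup>2 = (1 - c) * (1 + c)"
    by (simp add: s_def c_def sin_squared_eq power2_eq_square algebra_simps)
  have c: "c \<le> 1" "-1 \<le> c" by (simp_all add: c_def)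
  have "x * c \<le> s" using x_cos_le_sin[of x] assms by (simp add: s_def c_def)
  then have "x * (x * c) \<le> x * s" using assms by (intro mult_left_mono) auto
  then have "x\<^sup>2 * (c / s) \<le> x"
    using s by (simp add: pos_divide_le_eq power2_eq_square mult.assoc)
  moreover have "2 * s * c \<le> 2 * x - x * s\<^sup>2"
  proof (cases "c \<ge> 0")
    case True
    have "s \<le> x" using assms by (simp add: s_def sin_x_le_x)
    then have "s * c \<le> x * c" using True by (rule mult_right_mono)
    moreover have "x * s\<^sup>2 \<le> x * ((1 - c) * 2)"
      unfolding sc using assms c by (intro mult_left_mono) auto
    ultimately show ?thesis by (simp add: algebra_simps)
  next
    case False
    then have "s * c \<le> 0" using s by (simp add: mult_nonneg_nonpos)
    moreover have "s\<^sup>2 \<le> 1" by (simp add: s_def abs_square_le_1)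
    then have "x * s\<^sup>2 \<le> x * 1" using assms by (intro mult_left_mono) auto
    ultimately show ?thesis using assms(1) by linarith
  qed
  ultimately have "2 * s * c - 4 * x + 2 * (x\<^sup>2 * (c / s)) \<le> - (x * s\<^sup>2)" by linarith
  then show ?thesis
    using s by (simp add: pos_divide_le_eq s_def c_def cot_def)
qed

text \<open>
  By the previous bound, \<open>x\<^sup>2 cot x + x\<^sup>3 / 6\<close> is concave and lies below its tangent at \<open>a\<close>. The cubic
  term exceeds its own tangent by \<open>(x - a)\<^sup>2 (x + 2 a) / 6\<close>, which is at least \<open>a / 3 (x - a)\<^sup>2\<close>. The
  slope \<open>m\<close> is left unspecified: it is multiplied by deviations that add up to zero.
\<close>

lemma cot_square_strong_tangent_bound:
  fixes a :: real
  assumes a: "0 < a" "a < pi"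
  shows "\<exists>m. \<forall>x. 0 < x \<longrightarrow> x < pi \<longrightarrow>
           x\<^sup>2 * cot x \<le> a\<^sup>2 * cot a + m * (x - a) - a / 3 * (x - a)\<^sup>2"
proof -
  define f where "f = (\<lambda>x::real. - (x\<^sup>2 * cot x) - x ^ 3 / 6)"
  define f' where "f' = (\<lambda>x::real. - (2 * x * cot x - x\<^sup>2 / (sin x)\<^sup>2) - x\<^sup>2 / 2)"
  define f'' where "f'' = (\<lambda>x::real. - ((2 * sin x * cos x - 4 * x + 2 * x\<^sup>2 * cot x) / (sin x)\<^sup>2) - x)"
  have tangent: "f' a * (x - a) \<le> f x - f a" if x: "0 < x" "x < pi" for x
  proof (rule f''_imp_f'[where C = "{0<..<pi}" and f = f and f' = f' and f'' = f''])
    fix y :: real assume y: "y \<in> {0<..<pi}"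
    then have nz: "sin y \<noteq> 0" using sin_gt_zero[of y] by auto
    show "(f has_real_derivative f' y) (at y)"
      unfolding f_def f'_def
      by (rule derivative_eq_intros DERIV_cong[OF DERIV_cot] nz refl | simp)+
        (simp add: nz field_simps)
    have "(f' has_real_derivative
        - ((2 * cot y + 2 * y * (- inverse ((sin y)\<^sup>2)))
           - (2 * y * (sin y)\<^sup>2 - y\<^sup>2 * (2 * sin y * cos y)) / ((sin y)\<^sup>2 * (sin y)\<^sup>2)) - y) (at y)"
      unfolding f'_def
      by (rule derivative_eq_intros DERIV_cong[OF DERIV_cot] nz refl | (simp add: nz; fail))+
    moreover have "- ((2 * cot y + 2 * y * (- inverse ((sin y)\<^sup>2)))
           - (2 * y * (sin y)\<^sup>2 - y\<^sup>2 * (2 * sin y * cos y)) / ((sin y)\<^sup>2 * (sin y)\<^sup>2)) - y = f'' y"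
      proof -
      define s c where "s = sin y" and "c = cos y"
      have "s \<noteq> 0" using nz by (simp add: s_def)
      moreover have "s\<^sup>2 + c\<^sup>2 = 1" by (simp add: s_def c_def)
      ultimately have "- ((2 * (c / s) + 2 * y * (- inverse (s\<^sup>2)))
           - (2 * y * s\<^sup>2 - y\<^sup>2 * (2 * s * c)) / (s\<^sup>2 * s\<^sup>2)) - y
         = - ((2 * s * c - 4 * y + 2 * y\<^sup>2 * (c / s)) / s\<^sup>2) - y"
        by (simp add: field_simps power2_eq_square)
      then show ?thesis by (simp add: f''_def cot_def s_def c_def)
    qed
    ultimately show "(f' has_real_derivative f'' y) (at y)" by simp
    show "0 \<le> f'' y"
      using cot_square_second_derivative[of y] y by (simp add: f''_def)
  qed (use a x in auto)
  have "x\<^sup>2 * cot x \<le> a\<^sup>2 * cot a + (- f' a - a\<^sup>2 / 2) * (x - a) - a / 3 * (x - a)\<^sup>2"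
    if x: "0 < x" "x < pi" for x
  proof -
    have "x ^ 3 - a ^ 3 - 3 * a\<^sup>2 * (x - a) = 2 * a * (x - a)\<^sup>2 + x * (x - a)\<^sup>2"
      by (simp add: power2_eq_square power3_eq_cube algebra_simps)
    moreover have "0 \<le> x * (x - a)\<^sup>2" using x by simp
    ultimately have "2 * a * (x - a)\<^sup>2 \<le> x ^ 3 - a ^ 3 - 3 * a\<^sup>2 * (x - a)" by simp
    then have "a / 3 * (x - a)\<^sup>2 \<le> x ^ 3 / 6 - a ^ 3 / 6 - a\<^sup>2 / 2 * (x - a)"
      by (simp add: field_simps)
    moreover have "f' a * (x - a) \<le> - (x\<^sup>2 * cot x) - x ^ 3 / 6 + a\<^sup>2 * cot a + a ^ 3 / 6"
      using tangent[OF x] by (simp add: f_def)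
    moreover have "(- f' a - a\<^sup>2 / 2) * (x - a) = - (f' a * (x - a)) - a\<^sup>2 / 2 * (x - a)"
      by (simp add: algebra_simps)
    ultimately show ?thesis by linarith
  qed
  then show ?thesis by blast
qed

section \<open>The variance of the side lengths\<close>

lemma sum_square_deviation:
  fixes f :: "nat \<Rightarrow> real"
  shows "(\<Sum>i<n. (f i - c)\<^sup>2) = (\<Sum>i<n. (f i)\<^sup>2) - 2 * c * (\<Sum>i<n. f i) + real n * c\<^sup>2"
proof -
  have "(\<Sum>i<n. (f i - c)\<^sup>2) = (\<Sum>i<n. (f i)\<^sup>2 - 2 * c * f i + c\<^sup>2)"
    by (intro sum.cong) (auto simp: power2_diff algebra_simps)
  then show ?thesis
    by (simp only: sum.distrib sum_subtractf sum_distrib_left[symmetric] sum_constant card_lessThan)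
qed

text \<open>
  The weights \<open>\<alpha> i = \<pi> l i / L\<close> turn the area bound into a sum of values of \<open>x\<^sup>2 cot x\<close> at points with
  mean \<open>\<pi> / n\<close>, and strong concavity yields Jensen's inequality together with a gain that is
  proportional to the variance of the side lengths.
\<close>

lemma weighted_squares_le_perimeter:
  fixes l :: "nat \<Rightarrow> real"
  assumes "n \<ge> 2" and pos: "\<And>i. i < n \<Longrightarrow> 0 < l i"
  defines "L \<equiv> \<Sum>i<n. l i"
  shows "(\<Sum>i<n. (l i)\<^sup>2 * cot (pi * l i / L))
          \<le> L\<^sup>2 * cot (pi / n) / n - pi / (3 * n) * (\<Sum>i<n. (l i - L / n)\<^sup>2)"
proof -
  define a where "a = pi / n"
  have a: "0 < a" "a < pi" using \<open>n \<ge> 2\<close> by (auto simp: a_def field_simps)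
  have n: "real n > 0" using \<open>n \<ge> 2\<close> by simp
  have L: "L > 0" unfolding L_def using assms by (intro sum_pos) (auto simp: lessThan_empty_iff)
  have l_less: "l i < L" if "i < n" for i
  proof -
    have "0 < (\<Sum>j\<in>{..<n} - {i}. l j)"
    proof (rule sum_pos)
      have "(if i = 0 then 1 else 0) \<in> {..<n} - {i}" using \<open>n \<ge> 2\<close> by auto
      then show "{..<n} - {i} \<noteq> {}" by blast
    qed (use pos in auto)
    then show ?thesis
      unfolding L_def using sum.remove[of "{..<n}" i l] that by simp
  qed
  obtain m where m: "\<And>x. 0 < x \<Longrightarrow> x < pi \<Longrightarrow>
      x\<^sup>2 * cot x \<le> a\<^sup>2 * cot a + m * (x - a) - a / 3 * (x - a)\<^sup>2"
    using cot_square_strong_tangent_bound[OF a] by blast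
  have scale: "pi * l i / L - a = pi / L * (l i - L / n)" for i
    using L n by (simp add: a_def field_simps)
  have "(l i)\<^sup>2 * cot (pi * l i / L)
        \<le> L\<^sup>2 / (real n)\<^sup>2 * cot a + m * L / pi * (l i - L / n) - a / 3 * (l i - L / n)\<^sup>2"
    if "i < n" for i
  proof -
    have "0 < pi * l i / L" "pi * l i / L < pi"
      using pos[OF that] l_less[OF that] L by (auto simp: field_simps)
    from m[OF this] have
      "(L / pi)\<^sup>2 * ((pi * l i / L)\<^sup>2 * cot (pi * l i / L))
        \<le> (L / pi)\<^sup>2 * (a\<^sup>2 * cot a + m * (pi / L * (l i - L / n)) - a / 3 * (pi / L * (l i - L / n))\<^sup>2)"
      unfolding scale by (intro mult_left_mono) auto
    also have "(L / pi)\<^sup>2 * ((pi * l i / L)\<^sup>2 * cot (pi * l i / L)) = (l i)\<^sup>2 * cot (pi * l i / L)"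
      using L by (simp add: power2_eq_square)
    also have "(L / pi)\<^sup>2 * (a\<^sup>2 * cot a + m * (pi / L * (l i - L / n)) - a / 3 * (pi / L * (l i - L / n))\<^sup>2)
       = ((L / pi)\<^sup>2 * a\<^sup>2) * cot a + ((L / pi)\<^sup>2 * (pi / L)) * m * (l i - L / n)
          - ((L / pi)\<^sup>2 * (pi / L)\<^sup>2) * (a / 3) * (l i - L / n)\<^sup>2"
      by algebra
    also have "(L / pi)\<^sup>2 * a\<^sup>2 = L\<^sup>2 / (real n)\<^sup>2" by (simp add: a_def power_divide)
    also have "(L / pi)\<^sup>2 * (pi / L) = L / pi" using L by (simp add: power2_eq_square)
    also have "(L / pi)\<^sup>2 * (pi / L)\<^sup>2 = 1" using L by (simp add: power_divide)
    finally show ?thesis by (simp add: mult_ac)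
  qed
  then have "(\<Sum>i<n. (l i)\<^sup>2 * cot (pi * l i / L))
    \<le> (\<Sum>i<n. L\<^sup>2 / (real n)\<^sup>2 * cot a + m * L / pi * (l i - L / n) - a / 3 * (l i - L / n)\<^sup>2)"
    by (intro sum_mono) auto
  also have "\<dots> = real n * (L\<^sup>2 / (real n)\<^sup>2 * cot a) + m * L / pi * (\<Sum>i<n. l i - L / n)
                   - a / 3 * (\<Sum>i<n. (l i - L / n)\<^sup>2)"
    by (simp only: sum.distrib sum_subtractf sum_distrib_left[symmetric] sum_constant card_lessThan)
       (simp add: mult.left_commute)
  also have "(\<Sum>i<n. l i - L / n) = 0" using n by (simp add: sum_subtractf L_def)
  finally show ?thesis
    using n by (simp add: a_def power2_eq_square mult_ac)
qed

text \<open>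
  The left-hand side is the quadratic defect obtained from equal weights \<open>\<pi> / n\<close>. It differs from the
  defect formed with the perimeter exactly by \<open>cot (\<pi> / n)\<close> times the sum of the squared deviations of
  the side lengths from their mean, and the perimeter defect controls those deviations.
\<close>

lemma spectral_defect_le_perimeter_defect:
  fixes z :: "nat \<Rightarrow> complex"
  assumes "n \<ge> 3" and closed: "z n = z 0"
    and distinct: "\<And>i. i < n \<Longrightarrow> z (Suc i) \<noteq> z i"
  defines "a \<equiv> pi / n" and "l \<equiv> \<lambda>i. cmod (z (Suc i) - z i)"
  shows "cot a * (\<Sum>i<n. (l i)\<^sup>2) - 2 * fan_area2 n z
          \<le> (1 + 3 * cot a / a) * ((\<Sum>i<n. l i)\<^sup>2 * cot a / n - 2 * fan_area2 n z)"
proof -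
  define L where "L = (\<Sum>i<n. l i)"
  define V where "V = (\<Sum>i<n. (l i - L / n)\<^sup>2)"
  define D where "D = L\<^sup>2 * cot a / n - 2 * fan_area2 n z"
  have n: "real n > 0" using \<open>n \<ge> 3\<close> by simp
  have a: "0 < a" "a < pi / 2" using \<open>n \<ge> 3\<close> by (auto simp: a_def field_simps)
  have pos: "0 < l i" if "i < n" for i using distinct[OF that] by (simp add: l_def)
  have L: "L > 0" unfolding L_def using assms(1) pos
    by (intro sum_pos) (auto simp: lessThan_empty_iff)
  have total: "(\<Sum>i<n. pi * l i / L) = pi"
    using L by (simp add: L_def flip: sum_distrib_left sum_divide_distrib)
  have "2 * fan_area2 n z \<le> (\<Sum>i<n. (l i)\<^sup>2 * cot (pi * l i / L))"
    unfolding l_def using assms(1) closed pos L total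
    by (intro fan_area_le_weighted_squares) (auto simp: l_def)
  also have "\<dots> \<le> L\<^sup>2 * cot a / n - a / 3 * V"
    using weighted_squares_le_perimeter[of n l] assms(1) pos
    by (simp add: L_def V_def a_def)
  finally have "a / 3 * V \<le> D" unfolding D_def by linarith
  then have "V \<le> 3 / a * D" using a by (simp add: field_simps)
  then have "cot a * V \<le> cot a * (3 / a * D)"
    using cot_gt_zero[OF a] by (intro mult_left_mono) auto
  moreover have "V = (\<Sum>i<n. (l i)\<^sup>2) - L\<^sup>2 / n"
    using n unfolding V_def sum_square_deviation L_def[symmetric]
    by (simp add: field_simps power2_eq_square)
  moreover have "(1 + 3 * cot a / a) * D = D + cot a * (3 / a * D)"
    by (simp add: algebra_simps)
  moreover have "cot a * ((\<Sum>i<n. (l i)\<^sup>2) - L\<^sup>2 / n)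
      = cot a * (\<Sum>i<n. (l i)\<^sup>2) - 2 * fan_area2 n z - D"
    by (simp add: D_def algebra_simps)
  ultimately have "cot a * (\<Sum>i<n. (l i)\<^sup>2) - 2 * fan_area2 n z \<le> (1 + 3 * cot a / a) * D"
    by simp
  then show ?thesis by (simp add: D_def L_def)
qed

section \<open>Approximation by a regular polygon\<close>

lemma sin_ge_sin_end:
  fixes a x :: real
  assumes "0 \<le> a" "a \<le> x" "x \<le> pi - a"
  shows "sin a \<le> sin x"
proof (cases "x \<le> pi / 2")
  case True
  then show ?thesis using assms by (intro sin_monotone_2pi_le) auto
next
  case False
  then have "sin a \<le> sin (pi - x)" using assms by (intro sin_monotone_2pi_le) auto
  then show ?thesis by simp
qed

text \<open>
  With all weights equal to \<open>\<pi> / n\<close>, the squares in the fan identity compare consecutive diagonals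
  after each of them has been divided by the corresponding diagonal \<open>sin (a i) cis (a i)\<close> of a
  regular polygon. A small defect \<open>Q\<close> therefore makes these quotients \<open>y i\<close> nearly constant, and a
  polygon with constant quotients is regular.
\<close>

lemma near_regular_fan:
  fixes z :: "nat \<Rightarrow> complex"
  assumes "n \<ge> 3" and closed: "z n = z 0"
  defines "a \<equiv> pi / n"
  defines "Q \<equiv> cot a * (\<Sum>i<n. (cmod (z (Suc i) - z i))\<^sup>2) - 2 * fan_area2 n z"
  shows "0 \<le> Q \<and> (\<exists>C. \<forall>i\<le>n. cmod (z i - (z 0 - C + C * cis (2 * a * i))) \<le> n * sqrt (Q / sin a))"
proof -
  define w where "w = (\<lambda>i. z i - z 0)"
  define y where "y = (\<lambda>i. (cis (- (a * i)) * w i) /\<^sub>R sin (a * i))"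
  define \<eta> where "\<eta> = sqrt (Q / sin a)"
  have n: "real n > 0" using \<open>n \<ge> 3\<close> by simp
  have a: "0 < a" "a < pi / 2" using \<open>n \<ge> 3\<close> by (auto simp: a_def field_simps)
  have na: "real n * a = pi" using n by (simp add: a_def)
  have sa: "sin a > 0" using a by (simp add: sin_gt_zero)
  have sin_ge: "sin a \<le> sin (a * i)" if "1 \<le> i" "i < n" for i
  proof (rule sin_ge_sin_end)
    show "a \<le> a * i" using that a by simp
    have "a * (real i + 1) \<le> a * n" using that a by (intro mult_left_mono) auto
    then show "a * i \<le> pi - a" using na by (simp add: algebra_simps)
  qed (use a in auto)
  have w: "w i = sin (a * i) *\<^sub>R (cis (a * i) * y i)" if "1 \<le> i" "i < n" for i
    using sin_ge[OF that] sa by (simp add: y_def cis_mult flip: mult.assoc)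
  define t where "t = (\<lambda>i. sin (a * i) * sin (a * Suc i) / sin a * (cmod (y i - y (Suc i)))\<^sup>2)"
  have "Q = (\<Sum>i\<in>{1..<n - 1}.
      (cmod (sin (\<Sum>j<Suc i. a) *\<^sub>R (cis a * (z i - z 0)) - sin (\<Sum>j<i. a) *\<^sub>R (z (Suc i) - z 0)))\<^sup>2
        / (sin a * sin (\<Sum>j<i. a) * sin (\<Sum>j<Suc i. a)))"
    unfolding Q_def using closed_fan_identity[of n z "\<lambda>_. a"] assms(1) closed a na
    by (simp add: sum_distrib_left mult.commute)
  also have "\<dots> = (\<Sum>i\<in>{1..<n - 1}. t i)"
  proof (rule sum.cong[OF refl])
    fix i assume "i \<in> {1..<n - 1}"
    then have i: "1 \<le> i" "1 \<le> Suc i" "i < n" "Suc i < n" by auto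
    define s s' where "s = sin (a * i)" and "s' = sin (a * Suc i)"
    have s: "0 < s" "0 < s'"
      unfolding s_def s'_def using sin_ge[of i] sin_ge[of "Suc i"] sa i by linarith+
    have cis: "cis a * cis (a * i) = cis (a * Suc i)" by (simp add: cis_mult algebra_simps)
    have "s' *\<^sub>R (cis a * w i) - s *\<^sub>R w (Suc i)
        = (s * s') *\<^sub>R (cis (a * Suc i) * (y i - y (Suc i)))"
      using w[of i] w[of "Suc i"] i
      unfolding s_def[symmetric] s'_def[symmetric] cis[symmetric]
      by (simp add: scaleR_conv_of_real algebra_simps)
    then have "(cmod (s' *\<^sub>R (cis a * w i) - s *\<^sub>R w (Suc i)))\<^sup>2 / (sin a * s * s')
        = ((s * s') * cmod (y i - y (Suc i)))\<^sup>2 / (sin a * s * s')"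
      using s by (simp add: norm_mult)
    also have "\<dots> = s * s' / sin a * (cmod (y i - y (Suc i)))\<^sup>2"
      using s sa by (simp add: power2_eq_square)
    finally show "(cmod (sin (\<Sum>j<Suc i. a) *\<^sub>R (cis a * (z i - z 0)) - sin (\<Sum>j<i. a) *\<^sub>R (z (Suc i) - z 0)))\<^sup>2
        / (sin a * sin (\<Sum>j<i. a) * sin (\<Sum>j<Suc i. a)) = t i"
      by (simp add: s_def s'_def w_def t_def mult.commute del: of_nat_Suc sum.lessThan_Suc)
  qed
  finally have Q: "Q = (\<Sum>i\<in>{1..<n - 1}. t i)" .
  have t: "sin a * (cmod (y i - y (Suc i)))\<^sup>2 \<le> t i" if "i \<in> {1..<n - 1}" for i
  proof -
    have "sin a * sin a \<le> sin (a * i) * sin (a * Suc i)"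
      using sin_ge[of i] sin_ge[of "Suc i"] that sa
      by (intro mult_mono order_trans[OF less_imp_le[OF sa] sin_ge]) auto
    then have "sin a \<le> sin (a * i) * sin (a * Suc i) / sin a"
      using sa by (simp add: field_simps)
    then show ?thesis unfolding t_def by (intro mult_right_mono) auto
  qed
  then have t0: "0 \<le> t i" if "i \<in> {1..<n - 1}" for i
    using sa that by (smt (verit) mult_nonneg_nonneg zero_le_power2)
  then have Q0: "0 \<le> Q" unfolding Q by (rule sum_nonneg)
  have \<eta>0: "0 \<le> \<eta>" using Q0 sa by (simp add: \<eta>_def)
  have y_step: "cmod (y (Suc i) - y i) \<le> \<eta>" if "i \<in> {1..<n - 1}" for i
  proof -
    have "t i \<le> Q" unfolding Q using that t0 by (intro member_le_sum) auto
    then have "(cmod (y i - y (Suc i)))\<^sup>2 \<le> Q / sin a"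
      using t[OF that] sa by (simp add: field_simps)
    then show ?thesis
      unfolding \<eta>_def by (simp add: real_le_rsqrt norm_minus_commute)
  qed
  have y_close: "cmod (y (Suc i) - y 1) \<le> real i * \<eta>" if "Suc i < n" for i
    using that
  proof (induction i)
    case (Suc i)
    have "cmod (y (Suc (Suc i)) - y 1) \<le> cmod (y (Suc (Suc i)) - y (Suc i)) + cmod (y (Suc i) - y 1)"
      using norm_triangle_ineq[of "y (Suc (Suc i)) - y (Suc i)" "y (Suc i) - y 1"] by simp
    also have "\<dots> \<le> \<eta> + real i * \<eta>"
      using Suc y_step[of "Suc i"] by (intro add_mono) auto
    finally show ?case by (simp add: algebra_simps)
  qed simp
  \<comment> \<open>\<open>cis (2 x) - 1 = 2 \<i> sin x cis x\<close>, so the polygon with all quotients equal to \<open>y 1\<close> has radius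
    vector \<open>C\<close>.\<close>
  define C where "C = y 1 / (2 * \<i>)"
  have reg: "C * cis (2 * x) - C = sin x *\<^sub>R (cis x * y 1)" for x
  proof -
    have "cis (2 * x) - 1 = 2 * \<i> * (of_real (sin x) * cis x)"
      using sin_double[of x] cos_double_sin[of x]
      by (auto simp: complex_eq_iff power2_eq_square)
    then have "C * (cis (2 * x) - 1) = y 1 * (of_real (sin x) * cis x)"
      by (simp add: C_def mult.left_commute[of "y (Suc 0)" \<i>])
    then show ?thesis by (simp add: scaleR_conv_of_real algebra_simps)
  qed
  have "cmod (z i - (z 0 - C + C * cis (2 * a * i))) \<le> n * \<eta>" if i: "i \<le> n" for i
  proof -
    consider "i = 0" | "i = n" | "1 \<le> i" "i < n" using i by linarith
    then show ?thesis
    proof cases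
      case 1
      then show ?thesis using \<eta>0 by simp
    next
      case 2
      then have "cis (2 * a * i) = 1" using na by (simp add: mult.assoc mult.commute[of a])
      then show ?thesis using \<eta>0 closed 2 by simp
    next
      case 3
      then obtain j where j: "i = Suc j" by (cases i) auto
      have "z i - (z 0 - C + C * cis (2 * (a * i))) = w i - (C * cis (2 * (a * i)) - C)"
        by (simp add: w_def)
      also have "\<dots> = sin (a * i) *\<^sub>R (cis (a * i) * (y i - y 1))"
        unfolding reg using w[of i] 3 by (simp add: algebra_simps)
      also have "cmod \<dots> = \<bar>sin (a * i)\<bar> * cmod (y i - y 1)" by (simp add: norm_mult)
      also have "\<dots> \<le> 1 * (real j * \<eta>)"
        using y_close[of j] 3 j by (intro mult_mono) auto
      also have "\<dots> \<le> real n * \<eta>" using 3 j \<eta>0 by (simp add: mult_right_mono)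
      finally show ?thesis by (simp add: mult.assoc)
    qed
  qed
  then show ?thesis using Q0 unfolding \<eta>_def by blast
qed

lemma sum_cis_eq_0:
  fixes n :: nat
  assumes "n \<ge> 2"
  shows "(\<Sum>i<n. cis (2 * (pi / n) * i)) = 0"
proof -
  let ?w = "cis (2 * (pi / n))"
  have "?w ^ n = 1" using assms by (simp add: Complex.DeMoivre)
  moreover have "?w \<noteq> 1"
  proof
    assume "?w = 1"
    then have "cos (2 * (pi / n)) = 1" by (auto simp: complex_eq_iff)
    moreover have "cos (2 * (pi / n)) = 1 - 2 * (sin (pi / n))\<^sup>2" by (rule cos_double_sin)
    moreover have "sin (pi / n) > 0" using assms by (intro sin_gt_zero) (auto simp: field_simps)
    ultimately show False by simp
  qed
  ultimately have "(\<Sum>i<n. ?w ^ i) = 0" by (simp add: geometric_sum)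
  then show ?thesis by (simp add: Complex.DeMoivre mult_ac)
qed

text \<open>
  The vertices of the approximating regular polygon have mean \<open>z 0 - C\<close>, so the vertex barycenter
  differs from its centre by no more than the vertices differ from one another; moving the centre
  into the barycenter at most doubles the error.
\<close>

lemma near_regular_barycenter:
  fixes z :: "nat \<Rightarrow> complex"
  assumes "n \<ge> 3" and closed: "z n = z 0"
  defines "a \<equiv> pi / n" and "b \<equiv> (\<Sum>i<n. z i) /\<^sub>R n"
  defines "Q \<equiv> cot a * (\<Sum>i<n. (cmod (z (Suc i) - z i))\<^sup>2) - 2 * fan_area2 n z"
  shows "\<exists>C. \<forall>i\<le>n. cmod (z i - b - C * cis (2 * a * i)) \<le> 2 * real n * sqrt (Q / sin a)"
proof -
  define E where "E = real n * sqrt (Q / sin a)"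
  have n: "real n > 0" using \<open>n \<ge> 3\<close> by simp
  obtain C where C: "\<And>i. i \<le> n \<Longrightarrow> cmod (z i - (z 0 - C + C * cis (2 * a * i))) \<le> E"
    using near_regular_fan[OF assms(1) closed] unfolding E_def Q_def a_def by blast
  have "(\<Sum>i<n. z i - (z 0 - C + C * cis (2 * a * i))) = real n *\<^sub>R (b - (z 0 - C))"
  proof -
    have "(\<Sum>i<n. z i - (z 0 - C + C * cis (2 * a * i)))
        = (\<Sum>i<n. z i) - of_nat n * (z 0 - C) - C * (\<Sum>i<n. cis (2 * a * i))"
      by (simp add: sum_subtractf sum.distrib sum_distrib_left)
    also have "(\<Sum>i<n. cis (2 * a * i)) = 0" using sum_cis_eq_0[of n] assms(1) by (simp add: a_def)
    also have "(\<Sum>i<n. z i) = real n *\<^sub>R b" using n by (simp add: b_def)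
    finally show ?thesis by (simp add: scaleR_conv_of_real algebra_simps)
  qed
  moreover have "cmod (\<Sum>i<n. z i - (z 0 - C + C * cis (2 * a * i))) \<le> real n * E"
    using sum_norm_le[of "{..<n}" "\<lambda>i. z i - (z 0 - C + C * cis (2 * a * i))" "\<lambda>_. E"] C by simp
  ultimately have b: "cmod (b - (z 0 - C)) \<le> E" using n by simp
  have "cmod (z i - b - C * cis (2 * a * i)) \<le> 2 * real n * sqrt (Q / sin a)" if "i \<le> n" for i
  proof -
    have "cmod (z i - b - C * cis (2 * a * i))
        \<le> cmod (z i - (z 0 - C + C * cis (2 * a * i))) + cmod (b - (z 0 - C))"
      using norm_triangle_ineq4[of "z i - (z 0 - C + C * cis (2 * a * i))" "b - (z 0 - C)"]
      by (simp add: algebra_simps)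
    then show ?thesis using C[OF that] b by (simp add: E_def)
  qed
  then show ?thesis by blast
qed

section \<open>Variances of nearly regular polygons\<close>

lemma abs_le_abs_sin:
  fixes t :: real
  assumes "\<bar>t\<bar> \<le> pi / 2"
  shows "\<bar>t\<bar> / 2 \<le> \<bar>sin t\<bar>"
proof -
  have *: "t / 2 \<le> sin t" if "0 \<le> t" "t \<le> pi / 2" for t :: real
  proof -
    have c: "0 < cos (t / 2)" using that pi_gt_zero by (intro cos_gt_zero_pi) linarith+
    have "t / 2 * cos (t / 2) \<le> sin (t / 2)" using that by (intro x_cos_le_sin) auto
    then have "2 * (t / 2 * cos (t / 2)) * cos (t / 2) \<le> 2 * sin (t / 2) * cos (t / 2)"
      using c by (intro mult_right_mono) auto
    also have "\<dots> = sin t" using sin_double[of "t / 2"] by simp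
    also have "2 * (t / 2 * cos (t / 2)) * cos (t / 2) = t / 2 * (2 * (cos (t / 2))\<^sup>2)"
      by (simp add: power2_eq_square)
    also have "2 * (cos (t / 2))\<^sup>2 = 1 + cos t" using cos_double_cos[of "t / 2"] by simp
    finally have "t / 2 * (1 + cos t) \<le> sin t" .
    moreover have "t / 2 * 1 \<le> t / 2 * (1 + cos t)"
      using that cos_ge_zero[of t] by (intro mult_left_mono) auto
    ultimately show ?thesis by simp
  qed
  show ?thesis
  proof (cases "t \<ge> 0")
    case True then show ?thesis using *[of t] assms by simp
  next
    case False then show ?thesis using *[of "-t"] assms by simp
  qed
qed

text \<open>
  The cosine is flat at both ends of \<open>[0, \<pi>]\<close>, but a secant through the interior point \<open>2 a\<close> has
  slope bounded away from zero. This makes an angle near \<open>2 a\<close> a Lipschitz function of its cosine.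
\<close>

lemma cos_secant_lower_bound:
  fixes a x :: real
  assumes a: "0 < a" "a < pi / 2" and x: "0 \<le> x" "x \<le> pi"
  shows "min (sin a) (cos a) / 2 * \<bar>x - 2 * a\<bar> \<le> \<bar>cos x - cos (2 * a)\<bar>"
proof -
  let ?k = "min (sin a) (cos a)"
  have k: "0 < ?k" using a by (simp add: sin_gt_zero cos_gt_zero)
  have "?k \<le> sin ((x + 2 * a) / 2)"
  proof (cases "(x + 2 * a) / 2 \<le> pi / 2")
    case True
    then have "sin a \<le> sin ((x + 2 * a) / 2)" using a x by (intro sin_monotone_2pi_le) auto
    then show ?thesis by simp
  next
    case False
    have "sin (pi / 2 - a) \<le> sin (pi - (x + 2 * a) / 2)"
      using False a x by (intro sin_monotone_2pi_le) (auto simp: field_simps)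
    moreover have "sin (pi / 2 - a) = cos a" by (simp add: sin_diff)
    moreover have "sin (pi - (x + 2 * a) / 2) = sin ((x + 2 * a) / 2)" by (rule sin_pi_minus)
    ultimately show ?thesis by simp
  qed
  moreover have "\<bar>(2 * a - x) / 2\<bar> / 2 \<le> \<bar>sin ((2 * a - x) / 2)\<bar>"
    using a x by (intro abs_le_abs_sin) auto
  ultimately have "?k * (\<bar>(2 * a - x) / 2\<bar> / 2) \<le> sin ((x + 2 * a) / 2) * \<bar>sin ((2 * a - x) / 2)\<bar>"
    using k by (intro mult_mono) auto
  moreover have "cos x - cos (2 * a) = 2 * sin ((x + 2 * a) / 2) * sin ((2 * a - x) / 2)"
    by (rule cos_diff_cos)
  moreover have "0 < sin ((x + 2 * a) / 2)" using \<open>?k \<le> sin _\<close> k by linarith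
  ultimately show ?thesis
    by (simp add: abs_mult abs_minus_commute[of x])
qed

lemma variance_le_mean_square_deviation:
  assumes "n > 0"
  shows "variance_of n f \<le> (\<Sum>i<n. (f i - c)\<^sup>2) / n"
proof -
  define S where "S = (\<Sum>i<n. f i)"
  have "(\<Sum>i<n. (f i - c)\<^sup>2) / n - variance_of n f = (S / n - c)\<^sup>2"
    using assms unfolding variance_of_def sum_square_deviation S_def[symmetric]
    by (simp add: field_simps power2_eq_square)
  then show ?thesis by (smt (verit) zero_le_power2)
qed

lemma variance_le_square_of_deviation:
  assumes "n > 0" and "\<And>i. i < n \<Longrightarrow> \<bar>f i - c\<bar> \<le> B"
  shows "variance_of n f \<le> B\<^sup>2"
proof -
  have "(f i - c)\<^sup>2 \<le> B\<^sup>2" if "i < n" for i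
    using assms(2)[OF that] by (metis abs_ge_zero power2_abs power_mono)
  then have "(\<Sum>i<n. (f i - c)\<^sup>2) \<le> real n * B\<^sup>2"
    using sum_bounded_above[of "{..<n}" "\<lambda>i. (f i - c)\<^sup>2" "B\<^sup>2"] by simp
  then have "(\<Sum>i<n. (f i - c)\<^sup>2) / n \<le> B\<^sup>2" using assms(1) by (simp add: field_simps)
  then show ?thesis using variance_le_mean_square_deviation[OF assms(1), of f c] by linarith
qed

text \<open>
  Normalizing is Lipschitz at scale \<open>norm p\<close>. The convention \<open>sgn 0 = 0\<close> is compatible with this
  estimate, so that the angle bound derived from it covers vanishing radius vectors.
\<close>

lemma norm_mult_sgn_diff_le:
  fixes u p :: "'a::real_normed_vector"
  shows "norm p * norm (sgn u - sgn p) \<le> 2 * norm (u - p)"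
proof -
  have "norm p *\<^sub>R (sgn u - sgn p) = (norm p - norm u) *\<^sub>R sgn u + (u - p)"
  proof -
    have "norm x *\<^sub>R sgn x = x" for x :: 'a by (cases "x = 0") (simp_all add: sgn_div_norm)
    then show ?thesis by (simp add: algebra_simps)
  qed
  then have "norm p * norm (sgn u - sgn p) = norm ((norm p - norm u) *\<^sub>R sgn u + (u - p))"
    by (metis abs_norm_cancel norm_scaleR)
  also have "\<dots> \<le> \<bar>norm p - norm u\<bar> * norm (sgn u) + norm (u - p)"
    by (rule order_trans[OF norm_triangle_ineq]) simp
  also have "\<dots> \<le> norm (u - p) * 1 + norm (u - p)"
    using norm_triangle_ineq3[of u p]
    by (intro add_mono mult_mono) (auto simp: norm_sgn abs_minus_commute)
  finally show ?thesis by simp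
qed

lemma cos_angle_perturbation:
  fixes u v p q :: "'a::real_inner"
  assumes "norm p = r" "norm q = r"
  shows "r * \<bar>sgn u \<bullet> sgn v - sgn p \<bullet> sgn q\<bar> \<le> 2 * norm (u - p) + 2 * norm (v - q)"
proof -
  have r: "r \<ge> 0" using assms by auto
  have "sgn u \<bullet> sgn v - sgn p \<bullet> sgn q = (sgn u - sgn p) \<bullet> sgn v + sgn p \<bullet> (sgn v - sgn q)"
    by (simp add: inner_diff_left inner_diff_right)
  also have "\<bar>\<dots>\<bar> \<le> norm (sgn u - sgn p) * norm (sgn v) + norm (sgn p) * norm (sgn v - sgn q)"
    by (intro order_trans[OF abs_triangle_ineq] add_mono Cauchy_Schwarz_ineq2)
  also have "\<dots> \<le> norm (sgn u - sgn p) * 1 + 1 * norm (sgn v - sgn q)"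
    by (intro add_mono mult_mono) (auto simp: norm_sgn)
  finally have "r * \<bar>sgn u \<bullet> sgn v - sgn p \<bullet> sgn q\<bar>
      \<le> r * norm (sgn u - sgn p) + r * norm (sgn v - sgn q)"
    using r by (simp add: mult_left_mono flip: distrib_left)
  then show ?thesis
    using norm_mult_sgn_diff_le[of p u] norm_mult_sgn_diff_le[of q v] unfolding assms by linarith
qed

lemma inner_mult_left_complex:
  fixes c u v :: complex
  shows "(c * u) \<bullet> (c * v) = (cmod c)\<^sup>2 * (u \<bullet> v)"
  unfolding inner_complex_def cmod_power2 by (simp add: power2_eq_square algebra_simps)

lemma inner_cis_cis: "cis x \<bullet> cis y = cos (y - x)"
  by (simp add: inner_complex_def cos_diff)

text \<open>
  A regular polygon has vanishing variances, so each variance is quadratic in the distance \<open>F\<close> to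
  such a polygon. Sides and radii are 1-Lipschitz in their endpoints. The cosines of the central
  angles are only stable relative to the circumradius \<open>|C|\<close>; the missing factor \<open>|C|\<^sup>2\<close> is supplied by
  the area, which is at most of order \<open>|C|\<^sup>2 + F\<^sup>2\<close>.
\<close>

lemma variances_le_near_regular:
  fixes z :: "nat \<Rightarrow> complex" and C :: complex
  assumes "n \<ge> 3" and "0 \<le> S"
    and near: "\<And>i. i \<le> n \<Longrightarrow> cmod (z i - b - C * cis (2 * (pi / n) * i)) \<le> F"
    and area: "4 * S \<le> cot (pi / n) * (\<Sum>i<n. (cmod (z (Suc i) - z i))\<^sup>2)"
  defines "k \<equiv> min (sin (pi / n)) (cos (pi / n))"
  shows "variance_of n (\<lambda>i. cmod (z (Suc i) - z i)) + variance_of n (\<lambda>i. cmod (z i - b))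
          + S * variance_of n (\<lambda>i. arccos (((z i - b) \<bullet> (z (Suc i) - b))
                                       / (cmod (z i - b) * cmod (z (Suc i) - b))))
        \<le> (5 + 2 * real n * cot (pi / n) * (64 / k\<^sup>2 + pi\<^sup>2)) * F\<^sup>2"
proof -
  define a where "a = pi / n"
  define u where "u = (\<lambda>i. z i - b)"
  define p where "p = (\<lambda>i::nat. C * cis (2 * a * i))"
  define x where "x = (\<lambda>i. arccos ((u i \<bullet> u (Suc i)) / (cmod (u i) * cmod (u (Suc i)))))"
  have n: "n > 0" using \<open>n \<ge> 3\<close> by simp
  have a: "0 < a" "a < pi / 2" using \<open>n \<ge> 3\<close> by (auto simp: a_def field_simps)
  have k: "0 < k" using a by (simp add: k_def a_def[symmetric] sin_gt_zero cos_gt_zero)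
  have cot: "0 < cot a" using cot_gt_zero[OF a] .
  have up: "cmod (u i - p i) \<le> F" if "i \<le> n" for i
    using near[OF that] by (simp add: u_def p_def a_def)
  have F: "0 \<le> F" using up[of 0] by (meson norm_ge_zero order_trans zero_le)
  have p: "cmod (p i) = cmod C" for i by (simp add: p_def norm_mult)
  have p_Suc: "p (Suc i) = p i * cis (2 * a)" for i
    by (simp add: p_def cis_mult algebra_simps)
  define l0 where "l0 = cmod C * cmod (cis (2 * a) - 1)"
  have side: "\<bar>cmod (z (Suc i) - z i) - l0\<bar> \<le> 2 * F" if "i < n" for i
  proof -
    have "p (Suc i) - p i = p i * (cis (2 * a) - 1)" by (simp add: p_Suc algebra_simps)
    then have "l0 = cmod (p (Suc i) - p i)" by (simp add: l0_def norm_mult p)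
    then have "\<bar>cmod (z (Suc i) - z i) - l0\<bar> \<le> cmod ((z (Suc i) - z i) - (p (Suc i) - p i))"
      by (simp add: norm_triangle_ineq3)
    also have "\<dots> = cmod ((u (Suc i) - p (Suc i)) - (u i - p i))"
      by (simp add: u_def algebra_simps)
    also have "\<dots> \<le> F + F"
      using up[of i] up[of "Suc i"] that norm_triangle_ineq4[of "u (Suc i) - p (Suc i)" "u i - p i"]
      by simp
    finally show ?thesis by simp
  qed
  have sides: "variance_of n (\<lambda>i. cmod (z (Suc i) - z i)) \<le> (2 * F)\<^sup>2"
    by (rule variance_le_square_of_deviation[OF n side])
  have radii: "variance_of n (\<lambda>i. cmod (u i)) \<le> F\<^sup>2"
  proof (rule variance_le_square_of_deviation[OF n, where c = "cmod C"])
    fix i assume "i < n"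
    then show "\<bar>cmod (u i) - cmod C\<bar> \<le> F"
      using norm_triangle_ineq3[of "u i" "p i"] up[of i] p[of i] by simp
  qed
  have S: "S \<le> 2 * real n * cot a * ((cmod C)\<^sup>2 + F\<^sup>2)"
  proof -
    have "(cmod (z (Suc i) - z i))\<^sup>2 \<le> 8 * ((cmod C)\<^sup>2 + F\<^sup>2)" if "i < n" for i
    proof -
      have "cmod (cis (2 * a) - 1) \<le> 2" using norm_triangle_ineq4[of "cis (2 * a)" 1] by simp
      then have "l0 \<le> 2 * cmod C" unfolding l0_def by (simp add: mult_left_mono mult.commute)
      then have "cmod (z (Suc i) - z i) \<le> 2 * cmod C + 2 * F" using side[OF that] by simp
      then have "(cmod (z (Suc i) - z i))\<^sup>2 \<le> (2 * cmod C + 2 * F)\<^sup>2" by (intro power_mono) auto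
      moreover have "0 \<le> (cmod C - F)\<^sup>2" by simp
      ultimately show ?thesis by (simp add: power2_eq_square algebra_simps)
    qed
    then have "(\<Sum>i<n. (cmod (z (Suc i) - z i))\<^sup>2) \<le> n * (8 * ((cmod C)\<^sup>2 + F\<^sup>2))"
      using sum_bounded_above[of "{..<n}" "\<lambda>i. (cmod (z (Suc i) - z i))\<^sup>2" "8 * ((cmod C)\<^sup>2 + F\<^sup>2)"]
      by simp
    then have "cot a * (\<Sum>i<n. (cmod (z (Suc i) - z i))\<^sup>2) \<le> cot a * (n * (8 * ((cmod C)\<^sup>2 + F\<^sup>2)))"
      using cot by (intro mult_left_mono) auto
    then show ?thesis using area by (simp add: a_def[symmetric] algebra_simps)
  qed
  have angle: "S * (x i - 2 * a)\<^sup>2 \<le> 2 * real n * cot a * (64 / k\<^sup>2 + pi\<^sup>2) * F\<^sup>2" if i: "i < n" for i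
  proof -
    have cos_arg: "(u i \<bullet> u (Suc i)) / (cmod (u i) * cmod (u (Suc i))) = sgn (u i) \<bullet> sgn (u (Suc i))"
      by (simp add: sgn_div_norm field_simps)
    have "\<bar>sgn (u i) \<bullet> sgn (u (Suc i))\<bar> \<le> 1 * 1"
      by (intro order_trans[OF Cauchy_Schwarz_ineq2] mult_mono) (auto simp: norm_sgn)
    then have cosx: "cos (x i) = sgn (u i) \<bullet> sgn (u (Suc i))" and x: "0 \<le> x i" "x i \<le> pi"
      unfolding x_def cos_arg by (auto intro!: cos_arccos arccos_lbound arccos_ubound simp: abs_le_iff)
    have lin: "cmod C * \<bar>x i - 2 * a\<bar> \<le> 8 / k * F"
    proof (cases "C = 0")
      case False
      have "sgn (p i) \<bullet> sgn (p (Suc i)) = cos (2 * a)"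
      proof -
        have "p i \<bullet> p (Suc i) = (cmod C)\<^sup>2 * (cis (2 * a * i) \<bullet> cis (2 * a * Suc i))"
          unfolding p_def by (rule inner_mult_left_complex)
        also have "cis (2 * a * i) \<bullet> cis (2 * a * Suc i) = cos (2 * a)"
          unfolding inner_cis_cis by (simp add: algebra_simps)
        finally show ?thesis
          using False by (simp add: sgn_div_norm p field_simps power2_eq_square)
      qed
      then have "cmod C * \<bar>cos (x i) - cos (2 * a)\<bar> \<le> 2 * cmod (u i - p i) + 2 * cmod (u (Suc i) - p (Suc i))"
        unfolding cosx using cos_angle_perturbation[OF p p, of "u i" "u (Suc i)" i "Suc i"] by simp
      also have "\<dots> \<le> 4 * F" using up[of i] up[of "Suc i"] i by simp
      finally have "cmod C * \<bar>cos (x i) - cos (2 * a)\<bar> \<le> 4 * F" .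
      moreover have "cmod C * (k / 2 * \<bar>x i - 2 * a\<bar>) \<le> cmod C * \<bar>cos (x i) - cos (2 * a)\<bar>"
        using cos_secant_lower_bound[OF a x] by (intro mult_left_mono) (auto simp: k_def a_def)
      ultimately show ?thesis using k by (simp add: field_simps)
    qed (use F k in simp)
    have "(cmod C)\<^sup>2 * (x i - 2 * a)\<^sup>2 = (cmod C * \<bar>x i - 2 * a\<bar>)\<^sup>2" by (simp add: power_mult_distrib)
    also have "\<dots> \<le> (8 / k * F)\<^sup>2" using lin by (intro power_mono) auto
    finally have 1: "(cmod C)\<^sup>2 * (x i - 2 * a)\<^sup>2 \<le> 64 / k\<^sup>2 * F\<^sup>2"
      by (simp add: power_mult_distrib power_divide)
    have "\<bar>x i - 2 * a\<bar> \<le> pi" using x a by auto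
    then have "\<bar>x i - 2 * a\<bar>\<^sup>2 \<le> pi\<^sup>2" by (intro power_mono) auto
    then have 2: "F\<^sup>2 * (x i - 2 * a)\<^sup>2 \<le> pi\<^sup>2 * F\<^sup>2"
      by (simp add: mult.commute[of "pi\<^sup>2"] mult_left_mono)
    have "S * (x i - 2 * a)\<^sup>2 \<le> 2 * real n * cot a * ((cmod C)\<^sup>2 + F\<^sup>2) * (x i - 2 * a)\<^sup>2"
      using S by (intro mult_right_mono) auto
    also have "\<dots> = 2 * real n * cot a * ((cmod C)\<^sup>2 * (x i - 2 * a)\<^sup>2 + F\<^sup>2 * (x i - 2 * a)\<^sup>2)"
      by (simp add: algebra_simps)
    also have "\<dots> \<le> 2 * real n * cot a * (64 / k\<^sup>2 * F\<^sup>2 + pi\<^sup>2 * F\<^sup>2)"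
      using 1 2 cot by (intro mult_left_mono add_mono) auto
    finally show ?thesis by (simp add: algebra_simps)
  qed
  have "S * variance_of n x \<le> S * ((\<Sum>i<n. (x i - 2 * a)\<^sup>2) / n)"
    using assms(2) n by (intro mult_left_mono variance_le_mean_square_deviation)
  also have "\<dots> = (\<Sum>i<n. S * (x i - 2 * a)\<^sup>2) / n" by (simp add: sum_distrib_left)
  also have "\<dots> \<le> (n * (2 * real n * cot a * (64 / k\<^sup>2 + pi\<^sup>2) * F\<^sup>2)) / n"
  proof (rule divide_right_mono)
    show "(\<Sum>i<n. S * (x i - 2 * a)\<^sup>2) \<le> n * (2 * real n * cot a * (64 / k\<^sup>2 + pi\<^sup>2) * F\<^sup>2)"
      using sum_bounded_above[of "{..<n}" "\<lambda>i. S * (x i - 2 * a)\<^sup>2"] angle by simp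
  qed simp
  finally have "S * variance_of n x \<le> 2 * real n * cot a * (64 / k\<^sup>2 + pi\<^sup>2) * F\<^sup>2" using n by simp
  then show ?thesis
    using sides radii unfolding x_def u_def a_def by (simp add: algebra_simps)
qed

text \<open>
  All estimates combined, with one constant for all polygons. The number \<open>S\<close> stands for the area of
  the polygonal region, whose comparison with the signed area is a separate geometric matter.
\<close>

lemma closed_polygon_stability:
  assumes "n \<ge> 3"
  shows "\<exists>c::real. c > 0 \<and> (\<forall>(z :: nat \<Rightarrow> complex) S b.
    z n = z 0 \<longrightarrow> (\<forall>i<n. z (Suc i) \<noteq> z i) \<longrightarrow> b = (\<Sum>i<n. z i) /\<^sub>R n \<longrightarrow>
    0 \<le> S \<longrightarrow> 2 * S \<le> fan_area2 n z \<longrightarrow>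
    variance_of n (\<lambda>i. cmod (z (Suc i) - z i)) + variance_of n (\<lambda>i. cmod (z i - b))
          + S * variance_of n (\<lambda>i. arccos (((z i - b) \<bullet> (z (Suc i) - b))
                                       / (cmod (z i - b) * cmod (z (Suc i) - b))))
    \<le> c * ((\<Sum>i<n. cmod (z (Suc i) - z i))\<^sup>2 - 4 * real n * tan (pi / n) * S))"
proof -
  define a where "a = pi / n"
  define k where "k = min (sin a) (cos a)"
  define K where "K = 5 + 2 * real n * cot a * (64 / k\<^sup>2 + pi\<^sup>2)"
  define c where "c = K * (4 * (real n)\<^sup>2 / sin a) * ((1 + 3 * cot a / a) / (n * tan a))"
  have n: "real n > 0" using \<open>n \<ge> 3\<close> by simp
  have a: "0 < a" "a < pi / 2" using \<open>n \<ge> 3\<close> by (auto simp: a_def field_simps)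
  have pos: "0 < cot a" "0 < tan a" "0 < sin a"
    using a by (simp_all add: cot_gt_zero tan_gt_zero sin_gt_zero)
  have K: "K > 0" unfolding K_def using pos n
    by (intro add_pos_nonneg mult_nonneg_nonneg add_nonneg_nonneg) auto
  have "0 < 3 * cot a / a" using pos a by simp
  then have M: "0 < 1 + 3 * cot a / a" by linarith
  have c: "c > 0" unfolding c_def using pos n K M by (intro mult_pos_pos divide_pos_pos) auto
  show ?thesis
  proof (intro exI[of _ c] conjI c allI impI)
    fix z :: "nat \<Rightarrow> complex" and S :: real and b :: complex
    assume closed: "z n = z 0" and distinct: "\<forall>i<n. z (Suc i) \<noteq> z i"
      and b: "b = (\<Sum>i<n. z i) /\<^sub>R n" and S: "0 \<le> S" "2 * S \<le> fan_area2 n z"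
    define L where "L = (\<Sum>i<n. cmod (z (Suc i) - z i))"
    define Q where "Q = cot a * (\<Sum>i<n. (cmod (z (Suc i) - z i))\<^sup>2) - 2 * fan_area2 n z"
    define D where "D = L\<^sup>2 - 4 * real n * tan a * S"
    define F where "F = 2 * real n * sqrt (Q / sin a)"
    have "\<exists>C. \<forall>i\<le>n. cmod (z i - b - C * cis (2 * (pi / n) * i)) \<le> F"
      unfolding F_def Q_def b a_def by (rule near_regular_barycenter[OF assms closed])
    then obtain C where near: "\<And>i. i \<le> n \<Longrightarrow> cmod (z i - b - C * cis (2 * (pi / n) * i)) \<le> F"
      by auto
    have Q0: "0 \<le> Q"
      unfolding Q_def a_def by (rule near_regular_fan[OF assms closed, THEN conjunct1])
    have "4 * S \<le> cot (pi / n) * (\<Sum>i<n. (cmod (z (Suc i) - z i))\<^sup>2)"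
      using Q0 S(2) unfolding Q_def a_def by linarith
    from variances_le_near_regular[OF assms S(1) near this]
    have "variance_of n (\<lambda>i. cmod (z (Suc i) - z i)) + variance_of n (\<lambda>i. cmod (z i - b))
          + S * variance_of n (\<lambda>i. arccos (((z i - b) \<bullet> (z (Suc i) - b))
                                       / (cmod (z i - b) * cmod (z (Suc i) - b))))
        \<le> K * F\<^sup>2"
      by (simp add: K_def k_def a_def)
    also have "F\<^sup>2 = (4 * (real n)\<^sup>2 / sin a) * Q"
      using Q0 pos by (simp add: F_def power_mult_distrib)
    also have "Q \<le> (1 + 3 * cot a / a) * (L\<^sup>2 * cot a / n - 2 * fan_area2 n z)"
      unfolding Q_def L_def a_def
      by (rule spectral_defect_le_perimeter_defect[OF assms closed]) (use distinct in auto)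
    also have "L\<^sup>2 * cot a / n - 2 * fan_area2 n z \<le> D / (n * tan a)"
    proof -
      have "D / (n * tan a) = L\<^sup>2 * cot a / n - 4 * S"
        using n pos by (simp add: D_def cot_altdef field_simps)
      then show ?thesis using S(2) by simp
    qed
    finally have "variance_of n (\<lambda>i. cmod (z (Suc i) - z i)) + variance_of n (\<lambda>i. cmod (z i - b))
          + S * variance_of n (\<lambda>i. arccos (((z i - b) \<bullet> (z (Suc i) - b))
                                       / (cmod (z i - b) * cmod (z (Suc i) - b))))
        \<le> K * (4 * (real n)\<^sup>2 / sin a * ((1 + 3 * cot a / a) * (D / (n * tan a))))"
      using K pos M n by (simp add: mult_left_mono divide_right_mono)
    also have "\<dots> = c * D" by (simp add: c_def)
    finally show "variance_of n (\<lambda>i. cmod (z (Suc i) - z i)) + variance_of n (\<lambda>i. cmod (z i - b))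
          + S * variance_of n (\<lambda>i. arccos (((z i - b) \<bullet> (z (Suc i) - b))
                                       / (cmod (z i - b) * cmod (z (Suc i) - b))))
      \<le> c * ((\<Sum>i<n. cmod (z (Suc i) - z i))\<^sup>2 - 4 * real n * tan (pi / n) * S)"
      by (simp add: D_def L_def a_def)
  qed
qed

section \<open>The area of a convex polygon\<close>

definition cross2 :: "real^2 \<Rightarrow> real^2 \<Rightarrow> real" where
  "cross2 u v = u $ 1 * v $ 2 - u $ 2 * v $ 1"

lemma cross2_triangle: "cross2 (b - a) (c - a) = cross2 (c - b) (a - b)"
  by (simp add: cross2_def algebra_simps)

text \<open>
  In the plane, a linear functional that vanishes on \<open>e\<close> is a multiple of the cross product with \<open>e\<close>.
  This converts supporting hyperplanes into statements about orientation.
\<close>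

lemma orthogonal_eq_cross2:
  fixes a e :: "real^2"
  assumes "e \<noteq> 0" "a \<bullet> e = 0"
  obtains t where "\<And>y. a \<bullet> y = t * cross2 e y"
proof
  have e: "(e $ 1)\<^sup>2 + (e $ 2)\<^sup>2 > 0"
    using assms(1) by (auto simp: vec_eq_iff forall_2 sum_power2_gt_zero_iff)
  have o: "a $ 1 * e $ 1 + a $ 2 * e $ 2 = 0"
    using assms(2) by (simp add: inner_vec_def sum_2)
  let ?t = "cross2 e a / ((e $ 1)\<^sup>2 + (e $ 2)\<^sup>2)"
  show "a \<bullet> y = ?t * cross2 e y" for y
  proof -
    have "(a $ 1 * y $ 1 + a $ 2 * y $ 2) * ((e $ 1)\<^sup>2 + (e $ 2)\<^sup>2) = cross2 e a * cross2 e y"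
      using o unfolding cross2_def by algebra
    then show ?thesis
      unfolding inner_vec_def sum_2 inner_real_def times_divide_eq_left
      using e by (intro eq_divide_imp) auto
  qed
qed

lemma extreme_point_in_segment:
  assumes "x extreme_point_of P" "x \<in> closed_segment a b" "a \<in> P" "b \<in> P"
  shows "x = a \<or> x = b"
  using assms unfolding extreme_point_of_def open_segment_def by auto

text \<open>
  Faces of a polytope are exposed, so the line through an edge supports the polygon; and since the
  line meets the polygon in that edge only, which contains no vertices apart from its ends, the other
  vertices lie strictly on one side.
\<close>

lemma convex_ngon_edge_side:
  assumes ngon: "convex_ngon n P A" and "n \<ge> 3" and i: "i < n"
  defines "e \<equiv> A (Suc i mod n) - A i"
  shows "\<exists>s. (s = 1 \<or> s = -1) \<and> (\<forall>x\<in>P. 0 \<le> s * cross2 e (x - A i)) \<and>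
             (\<forall>j<n. j \<noteq> i \<longrightarrow> j \<noteq> Suc i mod n \<longrightarrow> 0 < s * cross2 e (A j - A i))"
proof -
  let ?i' = "Suc i mod n"
  let ?F = "closed_segment (A i) (A ?i')"
  have i': "?i' < n" "?i' \<noteq> i" using i \<open>n \<ge> 3\<close> by (auto simp: mod_Suc)
  have poly: "polytope P" and inj: "inj_on A {..<n}"
    and ext: "A ` {..<n} = {v. v extreme_point_of P}" and edge: "?F edge_of P"
    using ngon i by (auto simp: convex_ngon_def)
  have vertex: "A j extreme_point_of P" if "j < n" for j using ext that by blast
  then have inP: "A j \<in> P" if "j < n" for j using that by (auto simp: extreme_point_of_def)
  have "?F exposed_face_of P"
    using edge poly by (simp add: edge_of_def exposed_face_of_polyhedron polytope_imp_polyhedron)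
  then obtain a b where side: "P \<subseteq> {x. a \<bullet> x \<le> b}" and F: "?F = P \<inter> {x. a \<bullet> x = b}"
    by (auto simp: exposed_face_of_def)
  have on: "a \<bullet> A i = b" "a \<bullet> A ?i' = b"
    using F by (metis (mono_tags, lifting) IntD2 ends_in_segment mem_Collect_eq)+
  have "e \<noteq> 0" using inj i i' by (auto simp: e_def inj_on_def)
  moreover have "a \<bullet> e = 0" using on by (simp add: e_def inner_diff_right)
  ultimately obtain t where t: "\<And>y. a \<bullet> y = t * cross2 e y"
    using orthogonal_eq_cross2 by blast
  have val: "t * cross2 e (x - A i) = a \<bullet> x - b" for x
    using on(1) by (simp add: t[symmetric] inner_diff_right)
  have nonpos: "t * cross2 e (x - A i) \<le> 0" if "x \<in> P" for x
    using side that unfolding val by auto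
  have neg: "t * cross2 e (A j - A i) < 0" if "j < n" "j \<noteq> i" "j \<noteq> ?i'" for j
  proof -
    have "A j \<notin> ?F"
    proof
      assume "A j \<in> ?F"
      then have "A j = A i \<or> A j = A ?i'"
        using extreme_point_in_segment vertex inP i i' that(1) by blast
      then show False using inj that i i' by (auto simp: inj_on_def)
    qed
    then have "a \<bullet> A j \<noteq> b" using F inP[OF that(1)] by auto
    then show ?thesis using nonpos[OF inP[OF that(1)]] unfolding val by linarith
  qed
  have "\<exists>j<n. j \<noteq> i \<and> j \<noteq> ?i'"
  proof -
    have "card {i, ?i'} < card {..<n}" using \<open>n \<ge> 3\<close> by (simp add: card_insert_if)
    then have "\<not> {..<n} \<subseteq> {i, ?i'}" by (meson card_mono finite.emptyI finite_insert leD)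
    then show ?thesis by auto
  qed
  then have "t \<noteq> 0" using neg by fastforce
  \<comment> \<open>The functional is maximal on the edge, so \<open>t\<close> times the cross product is nonpositive on \<open>P\<close>;
    the orientation sign is \<open>- sgn t\<close>.\<close>
  have flip: "- sgn t * c = (- (t * c)) / \<bar>t\<bar>" for c
    using \<open>t \<noteq> 0\<close> by (simp add: sgn_if)
  show ?thesis
  proof (intro exI[of _ "- sgn t"] conjI ballI allI impI)
    show "- sgn t = 1 \<or> - sgn t = -1" using \<open>t \<noteq> 0\<close> by (auto simp: sgn_if)
    show "0 \<le> - sgn t * cross2 e (x - A i)" if "x \<in> P" for x
      unfolding flip using nonpos[OF that] by (intro divide_nonneg_nonneg) auto
    show "0 < - sgn t * cross2 e (A j - A i)" if "j < n" "j \<noteq> i" "j \<noteq> ?i'" for j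
      unfolding flip using neg[OF that] \<open>t \<noteq> 0\<close> by (intro divide_pos_pos) auto
  qed
qed

text \<open>
  All edges see the polygon on the same side: for two consecutive edges both signs are determined by
  the orientation of the triangle formed by their three endpoints.
\<close>

lemma convex_ngon_orientation:
  assumes ngon: "convex_ngon n P A" and "n \<ge> 3"
  shows "\<exists>s::real. (s = 1 \<or> s = -1) \<and> (\<forall>i<n.
    (\<forall>x\<in>P. 0 \<le> s * cross2 (A (Suc i mod n) - A i) (x - A i)) \<and>
    (\<forall>j<n. j \<noteq> i \<longrightarrow> j \<noteq> Suc i mod n \<longrightarrow> 0 < s * cross2 (A (Suc i mod n) - A i) (A j - A i)))"
proof -
  have "\<forall>i. \<exists>s::real. i < n \<longrightarrow> (s = 1 \<or> s = -1) \<and>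
      (\<forall>x\<in>P. 0 \<le> s * cross2 (A (Suc i mod n) - A i) (x - A i)) \<and>
      (\<forall>j<n. j \<noteq> i \<longrightarrow> j \<noteq> Suc i mod n \<longrightarrow> 0 < s * cross2 (A (Suc i mod n) - A i) (A j - A i))"
    using convex_ngon_edge_side[OF ngon \<open>n \<ge> 3\<close>] by blast
  from choice[OF this] obtain \<sigma> :: "nat \<Rightarrow> real"
    where pm: "\<And>i. i < n \<Longrightarrow> \<sigma> i = 1 \<or> \<sigma> i = -1"
    and half: "\<And>i x. i < n \<Longrightarrow> x \<in> P \<Longrightarrow> 0 \<le> \<sigma> i * cross2 (A (Suc i mod n) - A i) (x - A i)"
    and strict: "\<And>i j. i < n \<Longrightarrow> j < n \<Longrightarrow> j \<noteq> i \<Longrightarrow> j \<noteq> Suc i mod n \<Longrightarrow>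
           0 < \<sigma> i * cross2 (A (Suc i mod n) - A i) (A j - A i)"
    by blast
  have vertex: "A j \<in> P" if "j < n" for j
    using ngon that unfolding convex_ngon_def extreme_point_of_def by blast
  have step: "\<sigma> (Suc i) = \<sigma> i" if "Suc i < n" for i
  proof -
    define k where "k = Suc (Suc i) mod n"
    have k: "k < n" "k \<noteq> i" "k \<noteq> Suc i"
      using that \<open>n \<ge> 3\<close> by (auto simp: k_def mod_Suc)
    have "0 < \<sigma> i * cross2 (A (Suc i) - A i) (A k - A i)"
      using strict[of i k] k that by simp
    moreover have "0 \<le> \<sigma> (Suc i) * cross2 (A k - A (Suc i)) (A i - A (Suc i))"
      using half[of "Suc i" "A i"] vertex[of i] that by (simp add: k_def)
    ultimately show ?thesis
      using pm[of i] pm[of "Suc i"] that by (auto simp: cross2_triangle[of "A (Suc i)" "A i" "A k"])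
  qed
  have const: "\<sigma> i = \<sigma> 0" if "i < n" for i
    using that by (induction i) (use step in auto)
  show ?thesis
  proof (intro exI[of _ "\<sigma> 0"] conjI allI impI ballI)
    show "\<sigma> 0 = 1 \<or> \<sigma> 0 = -1" using pm[of 0] \<open>n \<ge> 3\<close> by simp
    show "0 \<le> \<sigma> 0 * cross2 (A (Suc i mod n) - A i) (x - A i)" if "i < n" "x \<in> P" for i x
      using half[OF that] const[OF that(1)] by simp
    show "0 < \<sigma> 0 * cross2 (A (Suc i mod n) - A i) (A j - A i)"
      if "i < n" "j < n" "j \<noteq> i" "j \<noteq> Suc i mod n" for i j
      using strict[OF that] const[OF that(1)] by simp
  qed
qed

text \<open>
  Cramer's rule in the plane.
\<close>

lemma cross2_cramer:
  "cross2 u v *\<^sub>R x = cross2 u x *\<^sub>R v - cross2 v x *\<^sub>R u"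
  by (simp add: vec_eq_iff forall_2 cross2_def algebra_simps)

text \<open>
  The three cross products are the barycentric coordinates of \<open>x\<close>, up to the common positive factor
  \<open>s * cross2 (u - p) (v - p)\<close>.
\<close>

lemma in_triangle_if_cross2:
  fixes p u v x :: "real^2"
  assumes s: "s = 1 \<or> s = (-1 :: real)"
    and pos: "0 < s * cross2 (u - p) (v - p)"
    and pu: "0 \<le> s * cross2 (u - p) (x - p)" and pv: "s * cross2 (v - p) (x - p) \<le> 0"
    and uv: "0 \<le> s * cross2 (v - u) (x - u)"
  shows "x \<in> convex hull {p, u, v}"
proof -
  define d where "d = s * cross2 (u - p) (v - p)"
  define \<alpha> where "\<alpha> = - (s * cross2 (v - p) (x - p)) / d"
  define \<beta> where "\<beta> = s * cross2 (u - p) (x - p) / d"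
  have d: "0 < d" using pos by (simp add: d_def)
  have scaled: "d * \<alpha> = - (s * cross2 (v - p) (x - p))" "d * \<beta> = s * cross2 (u - p) (x - p)"
    using d by (simp_all add: \<alpha>_def \<beta>_def)
  have "0 \<le> \<alpha>" "0 \<le> \<beta>" unfolding \<alpha>_def \<beta>_def using d pu pv by (simp_all add: divide_nonneg_pos divide_nonpos_pos)
  moreover have "\<alpha> + \<beta> \<le> 1"
  proof -
    have "cross2 (u - p) (v - p) + cross2 (v - p) (x - p) - cross2 (u - p) (x - p)
        = cross2 (v - u) (x - u)"
      by (simp add: cross2_def algebra_simps)
    then have "s * cross2 (v - u) (x - u)
        = s * cross2 (u - p) (v - p) + s * cross2 (v - p) (x - p) - s * cross2 (u - p) (x - p)"
      by (metis distrib_left right_diff_distrib)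
    then have "s * cross2 (v - u) (x - u) = d - d * \<alpha> - d * \<beta>"
      using scaled d_def by linarith
    then have "0 \<le> d * (1 - (\<alpha> + \<beta>))" using uv by (simp add: algebra_simps)
    then show ?thesis using d by (simp add: zero_le_mult_iff)
  qed
  moreover have "x = p + \<alpha> *\<^sub>R (u - p) + \<beta> *\<^sub>R (v - p)"
  proof -
    have "d *\<^sub>R (x - p) = s *\<^sub>R (cross2 (u - p) (v - p) *\<^sub>R (x - p))" by (simp add: d_def)
    also have "\<dots> = (d * \<beta>) *\<^sub>R (v - p) + (d * \<alpha>) *\<^sub>R (u - p)"
      unfolding cross2_cramer[of "u - p" "v - p"] scaled by (simp add: scaleR_right_diff_distrib)
    also have "\<dots> = d *\<^sub>R (\<alpha> *\<^sub>R (u - p) + \<beta> *\<^sub>R (v - p))"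
      by (simp add: scaleR_right_distrib)
    finally have "x - p = \<alpha> *\<^sub>R (u - p) + \<beta> *\<^sub>R (v - p)" using d by simp
    then show ?thesis by (simp add: algebra_simps)
  qed
  ultimately show ?thesis unfolding convex_hull_3_alt by blast
qed

lemma sign_change_nat:
  fixes g :: "nat \<Rightarrow> real"
  assumes "m < n" "0 \<le> g m" "g n \<le> 0"
  shows "\<exists>k. m \<le> k \<and> k < n \<and> 0 \<le> g k \<and> g (Suc k) \<le> 0"
proof (rule ccontr)
  assume no: "\<not> ?thesis"
  have "0 \<le> g k \<and> (m < k \<longrightarrow> 0 < g k)" if "m \<le> k" "k \<le> n" for k
    using that
  proof (induction k rule: dec_induct)
    case base
    then show ?case using assms by simp
  next
    case (step j)
    then have "m \<le> j" "j < n" "0 \<le> g j" by auto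
    then have "0 < g (Suc j)" using no by (meson not_le)
    then show ?case by simp
  qed
  from this[of n] show False using assms by simp
qed

text \<open>
  The fan of triangles with apex \<open>A 0\<close> covers the polygon. Seen from \<open>A 0\<close>, a point of the polygon
  lies on the inner side of the first side and of the last one, so there are two consecutive
  diagonals between which its orientation changes; together with the half-plane of the edge opposite
  to \<open>A 0\<close> they enclose it. The triangles are all oriented alike, so their areas add up to the signed
  fan area.
\<close>

lemma convex_ngon_area_le_fan:
  assumes ngon: "convex_ngon n P A" and n: "n \<ge> 3"
  obtains s :: real where "s = 1 \<or> s = -1"
    and "2 * area P \<le> (\<Sum>k\<in>{1..<n - 1}. s * cross2 (A k - A 0) (A (Suc k) - A 0))"
proof -
  obtain s :: real where s: "s = 1 \<or> s = -1"
    and half: "\<And>i x. i < n \<Longrightarrow> x \<in> P \<Longrightarrow> 0 \<le> s * cross2 (A (Suc i mod n) - A i) (x - A i)"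
    and strict: "\<And>i j. i < n \<Longrightarrow> j < n \<Longrightarrow> j \<noteq> i \<Longrightarrow> j \<noteq> Suc i mod n \<Longrightarrow>
           0 < s * cross2 (A (Suc i mod n) - A i) (A j - A i)"
    using convex_ngon_orientation[OF ngon n] by blast
  let ?T = "\<lambda>k. convex hull {A 0, A k, A (Suc k)}"
  have pos: "0 < s * cross2 (A k - A 0) (A (Suc k) - A 0)" if "k \<in> {1..<n - 1}" for k
  proof -
    have "Suc k < n" using that by auto
    then show ?thesis using strict[of k 0] that by (simp add: cross2_triangle[of "A k" "A 0"])
  qed
  have cover: "P \<subseteq> (\<Union>k\<in>{1..<n - 1}. ?T k)"
  proof
    fix x assume x: "x \<in> P"
    let ?g = "\<lambda>k. s * cross2 (A k - A 0) (x - A 0)"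
    have "0 \<le> ?g 1" using half[of 0 x] x n by simp
    moreover have "?g (n - 1) \<le> 0"
    proof -
      have "Suc (n - 1) mod n = 0" using n by simp
      then have "0 \<le> s * cross2 (A 0 - A (n - 1)) (x - A (n - 1))"
        using half[of "n - 1" x] x n by simp
      moreover have "cross2 (A 0 - A (n - 1)) (x - A (n - 1)) = - cross2 (A (n - 1) - A 0) (x - A 0)"
        by (simp add: cross2_def algebra_simps)
      ultimately show ?thesis by simp
    qed
    moreover have "1 < n - 1" using n by linarith
    ultimately obtain k where k: "1 \<le> k" "k < n - 1" "0 \<le> ?g k" "?g (Suc k) \<le> 0"
      using sign_change_nat[of 1 "n - 1" ?g] by blast
    have "Suc k < n" using k by simp
    then have "0 \<le> s * cross2 (A (Suc k) - A k) (x - A k)" using half[of k x] x by simp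
    then have "x \<in> ?T k"
      using in_triangle_if_cross2[OF s, of "A k" "A 0" "A (Suc k)" x] pos[of k] k by simp
    then show "x \<in> (\<Union>k\<in>{1..<n - 1}. ?T k)" using k by auto
  qed
  have "compact (?T k)" for k by (simp add: finite_imp_compact_convex_hull)
  then have T: "?T k \<in> lmeasurable" for k by (rule lmeasurable_compact)
  have P: "P \<in> sets lebesgue"
    using ngon by (auto simp: convex_ngon_def intro!: lmeasurable_compact fmeasurableD polytope_imp_compact)
  have "area P \<le> measure lebesgue (\<Union>k\<in>{1..<n - 1}. ?T k)"
    unfolding area_def using cover P \<open>\<And>k. compact (?T k)\<close>
    by (intro measure_mono_fmeasurable lmeasurable_compact compact_UN) auto
  also have "\<dots> \<le> (\<Sum>k\<in>{1..<n - 1}. measure lebesgue (?T k))"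
    using T by (intro measure_UNION_le) auto
  also have "\<dots> = (\<Sum>k\<in>{1..<n - 1}. s * cross2 (A k - A 0) (A (Suc k) - A 0) / 2)"
  proof (rule sum.cong[OF refl])
    fix k assume k: "k \<in> {1..<n - 1}"
    have "measure lebesgue (?T k) = measure lborel (?T k)"
      by (intro measure_completion) (simp add: \<open>compact (?T k)\<close> borel_compact)
    also have "\<dots> = \<bar>cross2 (A k - A 0) (A (Suc k) - A 0)\<bar> / 2"
      unfolding content_triangle by (simp add: cross2_def abs_minus_commute mult.commute)
    also have "\<dots> = s * cross2 (A k - A 0) (A (Suc k) - A 0) / 2"
      using pos[OF k] s by auto
    finally show "measure lebesgue (?T k) = s * cross2 (A k - A 0) (A (Suc k) - A 0) / 2" .
  qed
  finally have "2 * area P \<le> (\<Sum>k\<in>{1..<n - 1}. s * cross2 (A k - A 0) (A (Suc k) - A 0))"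
    by (simp flip: sum_divide_distrib)
  with s show ?thesis by (rule that)
qed

section \<open>The stability estimate for convex polygons\<close>

text \<open>
  The parameter \<open>s\<close> is the orientation, \<open>1\<close> or \<open>-1\<close>: a clockwise polygon is reflected, so that its
  image always has nonnegative signed area.
\<close>

definition plane_to_complex :: "real \<Rightarrow> real^2 \<Rightarrow> complex" where
  "plane_to_complex s v = Complex (v $ 1) (s * v $ 2)"

lemma plane_to_complex_linear:
  "plane_to_complex s (u - v) = plane_to_complex s u - plane_to_complex s v"
  "plane_to_complex s (c *\<^sub>R u) = c *\<^sub>R plane_to_complex s u"
  "plane_to_complex s (\<Sum>i\<in>I. f i) = (\<Sum>i\<in>I. plane_to_complex s (f i))"
proof -
  show "plane_to_complex s (\<Sum>i\<in>I. f i) = (\<Sum>i\<in>I. plane_to_complex s (f i))"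
    by (induction I rule: infinite_finite_induct)
       (auto simp: plane_to_complex_def complex_eq_iff algebra_simps)
qed (simp_all add: plane_to_complex_def complex_eq_iff algebra_simps)

lemma plane_to_complex_isometry:
  assumes "s = 1 \<or> s = -1"
  shows "plane_to_complex s u \<bullet> plane_to_complex s v = u \<bullet> v"
    "cmod (plane_to_complex s u) = norm u"
    "Im (cnj (plane_to_complex s u) * plane_to_complex s v) = s * cross2 u v"
proof -
  show inner: "plane_to_complex s u \<bullet> plane_to_complex s v = u \<bullet> v" for u v
    using assms by (auto simp: plane_to_complex_def inner_complex_def inner_vec_def sum_2)
  show "cmod (plane_to_complex s u) = norm u"
    using inner[of u u] by (simp add: norm_eq_sqrt_inner)
  show "Im (cnj (plane_to_complex s u) * plane_to_complex s v) = s * cross2 u v"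
    using assms by (auto simp: plane_to_complex_def cross2_def)
qed

theorem corollary1p2:
  fixes n :: nat
  assumes "n \<ge> 3"
  shows "\<exists>c::real. c > 0 \<and>
    (\<forall>(P :: (real^2) set) (A :: nat \<Rightarrow> real^2). convex_ngon n P A \<longrightarrow>
       c * isoperimetric_deficit n P A \<ge>
         variance_of n (side_length n A) + variance_of n (radius n A) +
         area P * variance_of n (central_angle n A))"
proof -
  obtain c :: real where "c > 0" and c: "\<And>(z :: nat \<Rightarrow> complex) S b.
      z n = z 0 \<Longrightarrow> (\<And>i. i < n \<Longrightarrow> z (Suc i) \<noteq> z i) \<Longrightarrow> b = (\<Sum>i<n. z i) /\<^sub>R n \<Longrightarrow>
      0 \<le> S \<Longrightarrow> 2 * S \<le> fan_area2 n z \<Longrightarrow>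
      variance_of n (\<lambda>i. cmod (z (Suc i) - z i)) + variance_of n (\<lambda>i. cmod (z i - b))
          + S * variance_of n (\<lambda>i. arccos (((z i - b) \<bullet> (z (Suc i) - b))
                                       / (cmod (z i - b) * cmod (z (Suc i) - b))))
      \<le> c * ((\<Sum>i<n. cmod (z (Suc i) - z i))\<^sup>2 - 4 * real n * tan (pi / n) * S)"
    using closed_polygon_stability[OF assms] by blast
  have "variance_of n (side_length n A) + variance_of n (radius n A)
          + area P * variance_of n (central_angle n A) \<le> c * isoperimetric_deficit n P A"
    if ngon: "convex_ngon n P A" for P A
  proof -
    obtain s where s: "s = 1 \<or> s = -1"
      and area: "2 * area P \<le> (\<Sum>k\<in>{1..<n - 1}. s * cross2 (A k - A 0) (A (Suc k) - A 0))"
      using convex_ngon_area_le_fan[OF ngon assms] by blast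
    let ?f = "plane_to_complex s"
    define z where "z = (\<lambda>i. ?f (A (i mod n)))"
    define b where "b = ?f (barycenter n A)"
    note iso = plane_to_complex_isometry[OF s]
    have diff: "?f u - ?f v = ?f (u - v)" for u v by (simp add: plane_to_complex_linear)
    have closed: "z n = z 0" by (simp add: z_def)
    have b: "b = (\<Sum>i<n. z i) /\<^sub>R n"
      by (simp add: b_def z_def barycenter_def plane_to_complex_linear divide_inverse)
    have side: "cmod (z (Suc i) - z i) = side_length n A i" if "i < n" for i
      using that by (simp add: z_def diff iso side_length_def dist_norm norm_minus_commute)
    have radius: "cmod (z i - b) = radius n A i" if "i < n" for i
      using that by (simp add: z_def b_def diff iso radius_def dist_norm norm_minus_commute)
    have angle: "arccos (((z i - b) \<bullet> (z (Suc i) - b)) / (cmod (z i - b) * cmod (z (Suc i) - b)))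
        = central_angle n A i" if "i < n" for i
      using that by (simp add: z_def b_def diff iso central_angle_def vector_angle_def)
    have distinct: "z (Suc i) \<noteq> z i" if "i < n" for i
    proof -
      have "Suc i mod n \<noteq> i" "Suc i mod n < n" using that assms by (auto simp: mod_Suc)
      then have "A (Suc i mod n) \<noteq> A i"
        using ngon that by (auto simp: convex_ngon_def inj_on_def)
      then have "side_length n A i \<noteq> 0" by (simp add: side_length_def)
      then show ?thesis using side[OF that] by auto
    qed
    have "fan_area2 n z = (\<Sum>k\<in>{1..<n - 1}. s * cross2 (A k - A 0) (A (Suc k) - A 0))"
    proof -
      have term_eq: "Im (cnj (z i - z 0) * (z (Suc i) - z 0))
          = s * cross2 (A (i mod n) - A 0) (A (Suc i mod n) - A 0)" for i
        by (simp only: z_def diff iso mod_0)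
      have "fan_area2 n z = (\<Sum>k\<in>{1..<n - 1}. s * cross2 (A (k mod n) - A 0) (A (Suc k mod n) - A 0))"
        unfolding fan_area2_def term_eq
      proof (rule sum.mono_neutral_right)
        show "\<forall>i\<in>{..<n} - {1..<n - 1}. s * cross2 (A (i mod n) - A 0) (A (Suc i mod n) - A 0) = 0"
        proof
          fix i assume "i \<in> {..<n} - {1..<n - 1}"
          then have "i = 0 \<or> Suc i = n" by auto
          then show "s * cross2 (A (i mod n) - A 0) (A (Suc i mod n) - A 0) = 0"
            by (auto simp: cross2_def)
        qed
      qed auto
      also have "\<dots> = (\<Sum>k\<in>{1..<n - 1}. s * cross2 (A k - A 0) (A (Suc k) - A 0))"
        by (intro sum.cong) auto
      finally show ?thesis .
    qed
    then have "2 * area P \<le> fan_area2 n z" using area by simp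
    moreover have "0 \<le> area P" by (simp add: area_def)
    ultimately have "variance_of n (\<lambda>i. cmod (z (Suc i) - z i)) + variance_of n (\<lambda>i. cmod (z i - b))
          + area P * variance_of n (\<lambda>i. arccos (((z i - b) \<bullet> (z (Suc i) - b))
                                       / (cmod (z i - b) * cmod (z (Suc i) - b))))
      \<le> c * ((\<Sum>i<n. cmod (z (Suc i) - z i))\<^sup>2 - 4 * real n * tan (pi / n) * area P)"
      using c[OF closed distinct b] by blast
    then show ?thesis
      using side radius angle
      by (simp add: variance_of_def isoperimetric_deficit_def perimeter_def)
  qed
  with \<open>c > 0\<close> show ?thesis by blast
qed

end
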